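(* Let $H_1,H_2$ be Hilbert spaces and let $\mathcal{A}\subset B(H_1)$ and $\mathcal{B}\subset B(H_2)$ be unital operator algebras. Assume that there exists a unital completely bounded isomorphism $\theta:\mathcal{C}\to\mathcal{A}$ where $\mathcal{C}$ is a unital $C^*$-algebra. Let $\varphi:\mathcal{A}\to\mathcal{B}$ be a unital completely bounded isomorphism. Then there exist two invertible operators $X\in B(H_1)$ and $Y\in B(H_2)$ such that the map $$XaX^{-1}\mapsto Y\varphi(a)Y^{-1}$$ (from $X\mathcal{A}X^{-1}$ onto $Y\mathcal{B}Y^{-1}$) is completely isometric.
   Context: A unital operator algebra $\mathcal{A}\subset B(H)$ is a (not necessarily self-adjoint) subalgebra of $B(H)$ containing the identity operator, with the matrix norms on $M_d(\mathcal{A})$ inherited from $M_d(B(H))=B(H^{d})$. A linear map $\psi$ is completely bounded if its amplifications $(a_{ij})\mapsto(\psi(a_{ij}))$ on $M_d$ are bounded uniformly in $d$, and completely isometric if all these amplifications are isometric. A unital completely bounded isomorphism is a bijective unital completely bounded algebra homomorphism (not assumed $*$-preserving) whose inverse is also completely bounded. *)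

theory Defs
  imports "HOL-Analysis.Analysis"
begin

section \<open>Complex Hilbert spaces\<close>

text \<open>
  The inner product \<open>cinner\<close> is linear in its first and conjugate-linear in its second argument.
  The norm, positivity and definiteness are inherited from the underlying real inner product
  \<open>inner x y = Re (cinner x y)\<close>.  The zero space is allowed.
\<close>

class chilbert = real_inner + complete_space +
  fixes scaleC :: "complex \<Rightarrow> 'a \<Rightarrow> 'a"
    and cinner :: "'a \<Rightarrow> 'a \<Rightarrow> complex"
  assumes scaleC_add_right: "scaleC c (x + y) = scaleC c x + scaleC c y"
    and scaleC_add_left: "scaleC (c + d) x = scaleC c x + scaleC d x"
    and scaleC_scaleC: "scaleC c (scaleC d x) = scaleC (c * d) x"
    and scaleR_scaleC: "scaleR r x = scaleC (complex_of_real r) x"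
    and cinner_add_left: "cinner (x + y) z = cinner x z + cinner y z"
    and cinner_scaleC_left: "cinner (scaleC c x) y = c * cinner x y"
    and cinner_commute: "cinner x y = cnj (cinner y x)"
    and inner_eq_Re_cinner: "inner x y = Re (cinner x y)"

lemma cinner_self: "cinner x x = complex_of_real ((norm x)\<^sup>2)" for x :: "'a::chilbert"
proof (rule complex_eqI)
  show "Re (cinner x x) = Re (complex_of_real ((norm x)\<^sup>2))"
    by (simp add: inner_eq_Re_cinner[symmetric] dot_square_norm)
  have "Im (cinner x x) = - Im (cinner x x)"
    using arg_cong[OF cinner_commute[of x x], of Im] by simp
  then show "Im (cinner x x) = Im (complex_of_real ((norm x)\<^sup>2))" by simp
qed

lemma norm_scaleC: "norm (scaleC c x) = cmod c * norm x" for x :: "'a::chilbert"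
proof -
  have "cinner (scaleC c x) (scaleC c x) = (c * cnj c) * cinner x x"
    by (metis cinner_scaleC_left cinner_commute complex_cnj_mult mult.assoc)
  then have "(norm (scaleC c x))\<^sup>2 = (cmod c)\<^sup>2 * (norm x)\<^sup>2"
    unfolding cinner_self complex_norm_square[symmetric]
    by (metis of_real_eq_iff of_real_mult)
  then have "(norm (scaleC c x))\<^sup>2 = (cmod c * norm x)\<^sup>2" by (simp add: power_mult_distrib)
  then show ?thesis by (simp add: power2_eq_iff_nonneg)
qed

lemma bounded_linear_scaleC: "bounded_linear (scaleC c :: 'a \<Rightarrow> 'a::chilbert)"
proof (rule bounded_linear_intro[where K = "cmod c"])
  fix r :: real and x y :: 'a
  show "scaleC c (x + y) = scaleC c x + scaleC c y" by (rule scaleC_add_right)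
  show "scaleC c (scaleR r x) = scaleR r (scaleC c x)"
    by (simp add: scaleR_scaleC scaleC_scaleC mult.commute)
  show "norm (scaleC c x) \<le> norm x * cmod c" by (simp add: norm_scaleC mult.commute)
qed

instantiation complex :: chilbert
begin
definition scaleC_complex :: "complex \<Rightarrow> complex \<Rightarrow> complex" where "scaleC_complex c x = c * x"
definition cinner_complex :: "complex \<Rightarrow> complex \<Rightarrow> complex" where "cinner_complex x y = x * cnj y"
instance
  by standard
    (simp_all add: scaleC_complex_def cinner_complex_def algebra_simps scaleR_conv_of_real
      inner_complex_def)
end

section \<open>Bounded operators\<close>

text \<open>
  \<open>'a \<Rightarrow>\<^sub>L 'a\<close> consists of the bounded \<^emph>\<open>real\<close>-linear operators with the operator norm;
  \<open>B(H)\<close> is the subset of complex-linear ones.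
\<close>

definition BH :: "('a::chilbert \<Rightarrow>\<^sub>L 'a) set" where
  "BH = {T. \<forall>c x. blinfun_apply T (scaleC c x) = scaleC c (blinfun_apply T x)}"

definition op_scale :: "complex \<Rightarrow> ('a::chilbert \<Rightarrow>\<^sub>L 'a) \<Rightarrow> ('a \<Rightarrow>\<^sub>L 'a)" where
  "op_scale c T = Blinfun (\<lambda>x. scaleC c (blinfun_apply T x))"

lemma op_scale_apply [simp]:
  "blinfun_apply (op_scale c T) x = scaleC c (blinfun_apply T x)"
  unfolding op_scale_def
  by (subst bounded_linear_Blinfun_apply)
    (auto intro: bounded_linear_compose[OF bounded_linear_scaleC] blinfun.bounded_linear_right)

definition adjoint_pair :: "('a::chilbert \<Rightarrow>\<^sub>L 'a) \<Rightarrow> ('a \<Rightarrow>\<^sub>L 'a) \<Rightarrow> bool" where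
  "adjoint_pair T S \<longleftrightarrow>
    (\<forall>x y. cinner (blinfun_apply T x) y = cinner x (blinfun_apply S y))"

definition inverse_pair :: "('a::chilbert \<Rightarrow>\<^sub>L 'a) \<Rightarrow> ('a \<Rightarrow>\<^sub>L 'a) \<Rightarrow> bool" where
  "inverse_pair X X' \<longleftrightarrow>
    X \<in> BH \<and> X' \<in> BH \<and> X o\<^sub>L X' = id_blinfun \<and> X' o\<^sub>L X = id_blinfun"

section \<open>Operator algebras\<close>

definition unital_operator_algebra :: "('a::chilbert \<Rightarrow>\<^sub>L 'a) set \<Rightarrow> bool" where
  "unital_operator_algebra A \<longleftrightarrow>
    A \<subseteq> BH \<and> id_blinfun \<in> A \<and>
    (\<forall>S\<in>A. \<forall>T\<in>A. S + T \<in> A \<and> S o\<^sub>L T \<in> A) \<and>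
    (\<forall>c. \<forall>T\<in>A. op_scale c T \<in> A)"

text \<open>
  A unital \<open>C\<^sup>*\<close>-algebra is a norm-closed self-adjoint unital operator algebra on some Hilbert
  space, an operator algebra like the others and with the matrix norms inherited in the same way.
  By Gelfand--Naimark every abstract unital \<open>C\<^sup>*\<close>-algebra arises so, and its matrix norms do not
  depend on the faithful representation.
\<close>

definition unital_cstar_algebra :: "('a::chilbert \<Rightarrow>\<^sub>L 'a) set \<Rightarrow> bool" where
  "unital_cstar_algebra C \<longleftrightarrow>
    unital_operator_algebra C \<and> closed C \<and> (\<forall>T\<in>C. \<exists>S\<in>C. adjoint_pair T S)"

section \<open>Matrix norms\<close>

text \<open>
  A vector of \<open>H\<^sup>d\<close> is a function \<open>x :: nat \<Rightarrow> 'a\<close> of which only the entries \<open>x j\<close> with \<open>j < d\<close>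
  matter, and a \<open>d \<times> d\<close> matrix of operators is a function \<open>a\<close> of which only the entries \<open>a i j\<close>
  with \<open>i, j < d\<close> matter.  \<open>matnorm d a\<close> is the norm of \<open>a\<close> as an operator on \<open>H\<^sup>d\<close>.
\<close>

definition vec_norm :: "nat \<Rightarrow> (nat \<Rightarrow> 'a::chilbert) \<Rightarrow> real" where
  "vec_norm d x = L2_set (\<lambda>i. norm (x i)) {..<d}"

definition mat_apply ::
  "nat \<Rightarrow> (nat \<Rightarrow> nat \<Rightarrow> ('a::chilbert \<Rightarrow>\<^sub>L 'a)) \<Rightarrow> (nat \<Rightarrow> 'a) \<Rightarrow> nat \<Rightarrow> 'a" where
  "mat_apply d a x = (\<lambda>i. \<Sum>j<d. blinfun_apply (a i j) (x j))"

definition matnorm :: "nat \<Rightarrow> (nat \<Rightarrow> nat \<Rightarrow> ('a::chilbert \<Rightarrow>\<^sub>L 'a)) \<Rightarrow> real" where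
  "matnorm d a = (SUP x\<in>{x. vec_norm d x \<le> 1}. vec_norm d (mat_apply d a x))"

text \<open>The supremum is over a nonempty set that is bounded above, hence a genuine one.\<close>

lemma matnorm_bdd_above:
  "bdd_above ((\<lambda>x. vec_norm d (mat_apply d a x)) ` {x. vec_norm d x \<le> 1})"
proof (rule bdd_aboveI2)
  fix x :: "nat \<Rightarrow> 'a" assume "x \<in> {x. vec_norm d x \<le> 1}"
  then have x: "norm (x j) \<le> 1" if "j < d" for j
    using member_le_L2_set[of "{..<d}" j "\<lambda>i. norm (x i)"] that by (simp add: vec_norm_def)
  have "vec_norm d (mat_apply d a x) \<le> (\<Sum>i<d. norm (mat_apply d a x i))"
    unfolding vec_norm_def by (rule L2_set_le_sum) simp
  also have "\<dots> \<le> (\<Sum>i<d. \<Sum>j<d. norm (a i j))"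
    unfolding mat_apply_def
  proof (intro sum_mono sum_norm_le)
    fix i j assume "j \<in> {..<d}"
    then have "norm (a i j) * norm (x j) \<le> norm (a i j) * 1"
      by (intro mult_left_mono x) auto
    then show "norm (blinfun_apply (a i j) (x j)) \<le> norm (a i j)"
      using norm_blinfun[of "a i j" "x j"] by linarith
  qed
  finally show "vec_norm d (mat_apply d a x) \<le> (\<Sum>i<d. \<Sum>j<d. norm (a i j))" .
qed

lemma matnorm_dom_nonempty: "(\<lambda>_. 0) \<in> {x. vec_norm d x \<le> 1}"
  by (simp add: vec_norm_def L2_set_def)

section \<open>Completely bounded maps\<close>

text \<open>A map is only ever considered on the algebra given as first argument.\<close>

definition mats_over :: "nat \<Rightarrow> ('a::chilbert \<Rightarrow>\<^sub>L 'a) set \<Rightarrow> (nat \<Rightarrow> nat \<Rightarrow> ('a \<Rightarrow>\<^sub>L 'a)) set" where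
  "mats_over d A = {a. \<forall>i<d. \<forall>j<d. a i j \<in> A}"

definition op_linear_on ::
  "('a::chilbert \<Rightarrow>\<^sub>L 'a) set \<Rightarrow> (('a \<Rightarrow>\<^sub>L 'a) \<Rightarrow> ('b::chilbert \<Rightarrow>\<^sub>L 'b)) \<Rightarrow> bool" where
  "op_linear_on A \<psi> \<longleftrightarrow>
    (\<forall>S\<in>A. \<forall>T\<in>A. \<psi> (S + T) = \<psi> S + \<psi> T) \<and>
    (\<forall>c. \<forall>T\<in>A. \<psi> (op_scale c T) = op_scale c (\<psi> T))"

definition completely_bounded_on ::
  "('a::chilbert \<Rightarrow>\<^sub>L 'a) set \<Rightarrow> (('a \<Rightarrow>\<^sub>L 'a) \<Rightarrow> ('b::chilbert \<Rightarrow>\<^sub>L 'b)) \<Rightarrow> bool" where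
  "completely_bounded_on A \<psi> \<longleftrightarrow> op_linear_on A \<psi> \<and>
    (\<exists>K. \<forall>d. \<forall>a\<in>mats_over d A. matnorm d (\<lambda>i j. \<psi> (a i j)) \<le> K * matnorm d a)"

definition completely_isometric_on ::
  "('a::chilbert \<Rightarrow>\<^sub>L 'a) set \<Rightarrow> (('a \<Rightarrow>\<^sub>L 'a) \<Rightarrow> ('b::chilbert \<Rightarrow>\<^sub>L 'b)) \<Rightarrow> bool" where
  "completely_isometric_on A \<psi> \<longleftrightarrow> op_linear_on A \<psi> \<and>
    (\<forall>d. \<forall>a\<in>mats_over d A. matnorm d (\<lambda>i j. \<psi> (a i j)) = matnorm d a)"

definition unital_cb_isomorphism ::
  "('a::chilbert \<Rightarrow>\<^sub>L 'a) set \<Rightarrow> ('b::chilbert \<Rightarrow>\<^sub>L 'b) set \<Rightarrow>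
    (('a \<Rightarrow>\<^sub>L 'a) \<Rightarrow> ('b \<Rightarrow>\<^sub>L 'b)) \<Rightarrow> bool" where
  "unital_cb_isomorphism A B \<psi> \<longleftrightarrow>
    bij_betw \<psi> A B \<and> \<psi> id_blinfun = id_blinfun \<and>
    (\<forall>S\<in>A. \<forall>T\<in>A. \<psi> (S o\<^sub>L T) = \<psi> S o\<^sub>L \<psi> T) \<and>
    completely_bounded_on A \<psi> \<and> completely_bounded_on B (inv_into A \<psi>)"

end

theory Submission
  imports Defs "HOL-Library.Poly_Mapping"
begin

text \<open>
  Let \<open>\<rho>\<close> stand for either of the unital completely bounded homomorphisms \<open>\<theta>\<close> and \<open>\<phi> \<circ> \<theta>\<close> of
  the C*-algebra \<open>C\<close>.  Each of them is similar to a star-homomorphism, by operators \<open>X\<close> and \<open>Y\<close>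
  respectively.  The two star-homomorphisms dominate each other in matrix norm up to constants,
  because \<open>\<phi>\<close> and its inverse are completely bounded; the C*-identity \<open>\<parallel>a\<parallel>\<^sup>2 = \<parallel>a\<^sup>* a\<parallel>\<close> replaces such a
  constant by its square root, hence by all its \<open>2\<^sup>n\<close>-th roots, hence by \<open>1\<close>
  (\<open>star_hom_matnorm_le\<close>).  So they have the same matrix norms, which is the claim.

  The substance is the similarity (\<open>similar_to_star_hom\<close>), Paulsen's theorem in a special case.
  What is needed is a quadratic form \<open>Q\<close> on \<open>H\<close>, equivalent to the square of the norm, with
  \<open>Q (\<rho> c h) \<le> Q h\<close> for all contractions \<open>c\<close> in \<open>C\<close>.  Then \<open>Q h = \<langle>T h, h\<rangle>\<close> for an operator \<open>T\<close>
  by Jordan--von Neumann and Riesz, and conjugation by the square root of \<open>T\<close> makes \<open>\<rho>\<close> contractive;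
  a contractive unital homomorphism of a C*-algebra preserves adjoints, since \<open>\<parallel>1 + t i a\<parallel>\<close>
  is \<open>1 + O(t\<^sup>2)\<close> exactly for self-adjoint \<open>a\<close>.

  To find \<open>Q\<close>, say that a finite multiset \<open>U\<close> of vectors of \<open>H\<close> dominates \<open>W\<close> if some
  contraction matrix \<open>a\<close> over \<open>C\<close> has an image \<open>\<rho>(a)\<close> that sends \<open>U\<close>, listed as a tuple, to \<open>W\<close>.
  A function \<open>Q\<close> that decreases along this relation, where it is summed over multisets, is
  decreased by \<open>\<rho> c\<close> for contractions \<open>c\<close>, and is a quadratic form because scalar rotations by
  45 degrees give the parallelogram law.  By Hahn--Banach (\<open>additive_functional_nonneg_on\<close>) such a \<open>Q\<close> between
  \<open>\<parallel>h\<parallel>\<^sup>2\<close> and \<open>K\<^sup>2 \<parallel>h\<parallel>\<^sup>2\<close> exists unless there is an obstruction \<open>x + a = y + b\<close>, where \<open>a\<close> dominates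
  \<open>b\<close> but \<open>\<Sum>\<parallel>x\<parallel>\<^sup>2 > K\<^sup>2 \<Sum>\<parallel>y\<parallel>\<^sup>2\<close>.  There is none: with \<open>a\<close> as a catalyst, \<open>l\<close> copies of \<open>y\<close>
  can be turned into \<open>l\<close> copies of \<open>x\<close>, so complete boundedness gives
  \<open>l \<Sum>\<parallel>x\<parallel>\<^sup>2 + \<Sum>\<parallel>a\<parallel>\<^sup>2 \<le> K\<^sup>2 (l \<Sum>\<parallel>y\<parallel>\<^sup>2 + \<Sum>\<parallel>a\<parallel>\<^sup>2)\<close> for every \<open>l\<close>, and the catalyst disappears in the
  limit (\<open>invariant_weight_exists\<close>).
\<close>

section \<open>Additive functionals that are nonnegative on a cone\<close>

text \<open>
  Hahn--Banach for an abelian group in place of a vector space; the real component supplies the order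
  unit.  A maximal proper submonoid \<open>M\<close> contains \<open>z\<close> or \<open>- z\<close> for every \<open>z\<close>, so that it defines a
  total preorder on the product, and \<open>- F v\<close> is the cut of the real line that \<open>v\<close> makes there.
\<close>

lemma additive_functional_nonneg_on:
  fixes K :: "('g::ab_group_add \<times> real) set"
  assumes unit: "\<And>s. 0 \<le> s \<Longrightarrow> (0, s) \<in> K"
    and add: "\<And>z w. z \<in> K \<Longrightarrow> w \<in> K \<Longrightarrow> z + w \<in> K"
    and proper: "\<And>s. (0, s) \<in> K \<Longrightarrow> 0 \<le> s"
    and absorbing: "\<And>v. \<exists>t. (v, t) \<in> K"
  shows "\<exists>F :: 'g \<Rightarrow> real. (\<forall>v w. F (v + w) = F v + F w) \<and> (\<forall>v t. (v, t) \<in> K \<longrightarrow> 0 \<le> F v + t)"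
proof -
  define \<A> where "\<A> = {M. K \<subseteq> M \<and> (\<forall>z\<in>M. \<forall>w\<in>M. z + w \<in> M) \<and> (\<forall>s. (0, s) \<in> M \<longrightarrow> 0 \<le> s)}"
  have "\<exists>M\<in>\<A>. \<forall>N\<in>\<A>. M \<subseteq> N \<longrightarrow> N = M"
  proof (rule subset_Zorn_nonempty)
    show "\<A> \<noteq> {}" using add proper by (auto simp: \<A>_def)
    fix \<C> assume ne: "\<C> \<noteq> {}" and ch: "subset.chain \<A> \<C>"
    have sub: "\<C> \<subseteq> \<A>" and comp: "\<And>M N. M \<in> \<C> \<Longrightarrow> N \<in> \<C> \<Longrightarrow> M \<subseteq> N \<or> N \<subseteq> M"
      using ch by (auto simp: subset_chain_def)
    have "K \<subseteq> \<Union>\<C>" using ne sub unfolding \<A>_def by blast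
    moreover have "z + w \<in> \<Union>\<C>" if zw: "z \<in> \<Union>\<C>" "w \<in> \<Union>\<C>" for z w
    proof -
      obtain M N where "M \<in> \<C>" "z \<in> M" "N \<in> \<C>" "w \<in> N" using zw by blast
      then obtain P where "P \<in> \<C>" "z \<in> P" "w \<in> P" using comp by blast
      then show ?thesis using sub by (auto simp: \<A>_def)
    qed
    ultimately show "\<Union>\<C> \<in> \<A>" using sub by (auto simp: \<A>_def)
  qed
  then obtain M where M: "M \<in> \<A>" and max: "\<And>N. N \<in> \<A> \<Longrightarrow> M \<subseteq> N \<Longrightarrow> N = M" by blast
  have KM: "K \<subseteq> M" and addM: "\<And>z w. z \<in> M \<Longrightarrow> w \<in> M \<Longrightarrow> z + w \<in> M"
    and properM: "\<And>s. (0, s) \<in> M \<Longrightarrow> 0 \<le> s" using M by (auto simp: \<A>_def)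
  have zeroM: "0 \<in> M" using unit[of 0] KM by (auto simp: zero_prod_def)
  define nm :: "nat \<Rightarrow> 'g \<times> real \<Rightarrow> 'g \<times> real" where "nm n z = (\<Sum>i<n. z)" for n z
  have nm_M: "nm n z \<in> M" if "z \<in> M" for n z
    by (induction n) (use that zeroM addM in \<open>auto simp: nm_def\<close>)
  have nm_plus: "nm (m + n) z = nm m z + nm n z" for m n z
    by (induction n) (auto simp: nm_def algebra_simps)
  have nm_add: "nm n (z + w) = nm n z + nm n w" for n z w by (simp add: nm_def sum.distrib)
  have nm_comm: "nm m (nm n z) = nm n (nm m z)" for m n z unfolding nm_def by (rule sum.swap)
  have nm_minus: "nm n (- z) = - nm n z" for n z by (simp add: nm_def sum_negf)
  have nm_unit: "nm n (0, s) = (0, of_nat n * s)" for n s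
    by (simp add: nm_def prod_eq_iff fst_sum snd_sum)
  \<comment> \<open>By maximality: the submonoid generated by \<open>M\<close> and \<open>z\<close> contains a negative real.\<close>
  have neg: "\<exists>k n s. k \<in> M \<and> s < 0 \<and> (0, s) = k + nm n z" if z: "z \<notin> M" for z
  proof (rule ccontr)
    assume no: "\<not> ?thesis"
    define N where "N = {k + nm n z |k n. k \<in> M}"
    have sub: "M \<subseteq> N"
    proof
      fix k assume "k \<in> M"
      then have "k + nm 0 z \<in> N" unfolding N_def by blast
      then show "k \<in> N" by (simp add: nm_def)
    qed
    have "N \<in> \<A>"
      unfolding \<A>_def
    proof (intro CollectI conjI ballI allI impI)
      show "K \<subseteq> N" using KM sub by blast
    next
      fix a b assume "a \<in> N" "b \<in> N"
      then obtain k n k' n' where "a = k + nm n z" "b = k' + nm n' z" "k \<in> M" "k' \<in> M"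
        unfolding N_def by blast
      then have "a + b = (k + k') + nm (n + n') z" "k + k' \<in> M" by (simp_all add: nm_plus addM)
      then show "a + b \<in> N" unfolding N_def by blast
    next
      fix s assume "(0, s) \<in> N"
      then show "0 \<le> s" using no unfolding N_def by (force simp: not_less)
    qed
    then have "N = M" using max sub by blast
    moreover have "0 + nm 1 z \<in> N" unfolding N_def using zeroM by blast
    ultimately show False using z by (simp add: nm_def)
  qed
  \<comment> \<open>Multiples of \<open>z\<close> and of \<open>- z\<close> that are both negative modulo \<open>M\<close> cancel after cross-multiplication.\<close>
  have total: "z \<in> M \<or> - z \<in> M" for z
  proof (rule ccontr)
    assume "\<not> ?thesis"
    then obtain k n s k' n' s' where k: "k \<in> M" "s < 0" "(0, s) = k + nm n z"
      and k': "k' \<in> M" "s' < 0" "(0, s') = k' + nm n' (- z)"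
      using neg[of z] neg[of "- z"] by blast
    have "nm n' (0, s) + nm n (0, s') = nm n' k + nm n k'"
      unfolding k(3) k'(3) nm_add nm_minus nm_comm[of n' n] by simp
    then have "(0, of_nat n' * s + of_nat n * s') \<in> M"
      using addM[OF nm_M[OF k(1)] nm_M[OF k'(1)]] by (simp add: nm_unit)
    then have ge: "0 \<le> of_nat n' * s + of_nat n * s'" by (rule properM)
    have "n \<noteq> 0"
    proof
      assume "n = 0"
      then have "(0, s) \<in> M" using k by (simp add: nm_def)
      then show False using properM k(2) by fastforce
    qed
    then have "of_nat n * s' < 0" using k'(2) by (simp add: mult_pos_neg)
    moreover have "of_nat n' * s \<le> 0" using k(2) by (simp add: mult_nonneg_nonpos)
    ultimately show False using ge by linarith
  qed
  define p where "p v = Inf {t. (v, t) \<in> M}" for v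
  have bdd: "bdd_below {t. (v, t) \<in> M}" for v
  proof -
    obtain t' where "(- v, t') \<in> M" using absorbing KM by blast
    then have "- t' \<le> t" if "(v, t) \<in> M" for t
      using addM[OF that, of "(- v, t')"] properM[of "t + t'"] by simp
    then show ?thesis by (intro bdd_belowI[of _ "- t'"]) auto
  qed
  have ne: "{t. (v, t) \<in> M} \<noteq> {}" for v using absorbing KM by blast
  have p_le: "p v \<le> t" if "(v, t) \<in> M" for v t
    unfolding p_def by (rule cInf_lower) (use that bdd in auto)
  have approx: "\<exists>t. (v, t) \<in> M \<and> t < p v + e" if "e > 0" for v e
    using cInf_lessD[OF ne[of v], of "p v + e"] that unfolding p_def by auto
  have sub: "p (v + w) \<le> p v + p w" for v w
  proof (rule field_le_epsilon)
    fix e :: real assume "e > 0"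
    then obtain s t where "(v, s) \<in> M" "s < p v + e/2" "(w, t) \<in> M" "t < p w + e/2"
      using approx[of "e/2"] by (meson half_gt_zero)
    then show "p (v + w) \<le> p v + p w + e" using p_le[of "v + w" "s + t"] addM[of "(v, s)" "(w, t)"] by simp
  qed
  have p0: "0 \<le> p 0" unfolding p_def by (rule cInf_greatest[OF ne]) (auto intro: properM)
  have odd: "p (- v) = - p v" for v
  proof (rule antisym)
    show "p (- v) \<le> - p v"
    proof (rule field_le_epsilon)
      fix e :: real assume "e > 0"
      then have "(v, p v - e) \<notin> M" using p_le[of v "p v - e"] by auto
      then have "(- v, - (p v - e)) \<in> M" using total[of "(v, p v - e)"] by auto
      then show "p (- v) \<le> - p v + e" using p_le by fastforce
    qed
    show "- p v \<le> p (- v)" using sub[of v "- v"] p0 by simp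
  qed
  have "p (v + w) = p v + p w" for v w
    using sub[of v w] sub[of "- v" "- w"] odd[of v] odd[of w] odd[of "v + w"] by simp
  then have "\<forall>v w. - p (v + w) = - p v + - p w" by simp
  moreover have "\<forall>v t. (v, t) \<in> K \<longrightarrow> 0 \<le> - p v + t" using p_le KM by fastforce
  ultimately show ?thesis by (intro exI[of _ "\<lambda>v. - p v"]) blast
qed

section \<open>Weights that decrease along a relation of multisets\<close>

text \<open>
  Multisets embed here in the free abelian group on the vectors: no relation of the vector space is
  imposed, so equality of formal sums is equality of multisets.
\<close>

definition formal_sum :: "'a multiset \<Rightarrow> ('a \<Rightarrow>\<^sub>0 int)" where
  "formal_sum a = (\<Sum>x\<in>#a. Poly_Mapping.single x 1)"

lemma formal_sum_simps [simp]:
  "formal_sum {#} = 0" "formal_sum (a + b) = formal_sum a + formal_sum b"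
  by (simp_all add: formal_sum_def)

lemma formal_sum_inj: "formal_sum a = formal_sum b \<Longrightarrow> a = b"
proof -
  have cnt: "Poly_Mapping.lookup (formal_sum a) x = int (count a x)" for a :: "'a multiset" and x
    by (induction a) (auto simp: formal_sum_def lookup_add lookup_single when_def)
  assume "formal_sum a = formal_sum b"
  then have "int (count a x) = int (count b x)" for x by (metis cnt)
  then show "a = b" by (intro multiset_eqI) simp
qed

lemma formal_sum_diff_surj: "\<exists>a b. v = formal_sum a - formal_sum b"
proof (induction v rule: frag_induction[OF subset_UNIV])
  case 1
  have "(0 :: 'a \<Rightarrow>\<^sub>0 int) = formal_sum {#} - formal_sum {#}" by simp
  then show ?case by blast
next
  case (2 h)
  have "frag_of h = formal_sum {#h#} - formal_sum {#}" by (simp add: formal_sum_def)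
  then show ?case by blast
next
  case (3 v w)
  then obtain a b c d where "v = formal_sum a - formal_sum b" "w = formal_sum c - formal_sum d" by blast
  then have "v - w = formal_sum (a + d) - formal_sum (b + c)" by simp
  then show ?case by blast
qed

text \<open>
  By Hahn--Banach on the free abelian group, the only obstruction to \<open>Q\<close> is an identity
  \<open>x + a = y + b\<close> with \<open>R a b\<close> that violates \<open>\<Sum>n(x) \<le> k \<Sum>n(y)\<close>.  In such an identity \<open>a\<close> acts as a
  catalyst: \<open>y + a\<close> is above \<open>y + b = x + a\<close>, and \<open>a\<close> can be used again.  Hence \<open>l\<close> copies of \<open>y\<close>
  with \<open>a\<close> are above \<open>l\<close> copies of \<open>x\<close> with \<open>a\<close>, and the contribution of \<open>a\<close> to the assumed
  bound is negligible as \<open>l\<close> grows.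
\<close>

lemma invariant_weight_exists:
  fixes R :: "'h multiset \<Rightarrow> 'h multiset \<Rightarrow> bool" and n :: "'h \<Rightarrow> real" and k :: real
  assumes refl: "\<And>a. R a a"
    and trans: "\<And>a b c. R a b \<Longrightarrow> R b c \<Longrightarrow> R a c"
    and add: "\<And>a b a' b'. R a b \<Longrightarrow> R a' b' \<Longrightarrow> R (a + a') (b + b')"
    and bound: "\<And>a b. R a b \<Longrightarrow> (\<Sum>h\<in>#b. n h) \<le> k * (\<Sum>h\<in>#a. n h)"
  shows "\<exists>Q. (\<forall>h. n h \<le> Q h \<and> Q h \<le> k * n h) \<and>
    (\<forall>a b. R a b \<longrightarrow> (\<Sum>h\<in>#b. Q h) \<le> (\<Sum>h\<in>#a. Q h))"
proof -
  define N where "N a = (\<Sum>h\<in>#a. n h)" for a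
  have N_add [simp]: "N (a + b) = N a + N b" for a b by (simp add: N_def)
  have N0 [simp]: "N {#} = 0" by (simp add: N_def)
  define K where "K = {(formal_sum x - formal_sum y + (formal_sum a - formal_sum b), t) | x y a b t.
      R a b \<and> k * N y - N x \<le> t}"
  have cycle: "N x \<le> k * N y" if R: "R a b" and eq: "x + a = y + b" for x y a b
  proof -
    have it: "R (repeat_mset l y + a) (repeat_mset l x + a)" for l
    proof (induction l)
      case 0
      show ?case by (simp add: refl)
    next
      case (Suc l)
      have "R (repeat_mset l y + (y + a)) (repeat_mset l y + (x + a))"
        unfolding eq by (intro add refl R)
      moreover have "R (repeat_mset l y + (x + a)) (repeat_mset l x + (x + a))"
        using add[OF Suc.IH refl[of x]] by (simp add: ac_simps)
      ultimately have "R (repeat_mset l y + (y + a)) (repeat_mset l x + (x + a))" by (rule trans)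
      then show ?case by (simp add: ac_simps)
    qed
    have N_rep: "N (repeat_mset l x) = real l * N x" for l x
      by (induction l) (simp_all add: algebra_simps)
    have "real l * (N x - k * N y) \<le> k * N a - N a" for l
      using bound[OF it[of l]] by (simp add: N_def[symmetric] N_rep algebra_simps)
    then show ?thesis
      by (metis diff_gt_0_iff_gt ex_less_of_nat_mult not_le)
  qed
  have "\<exists>F :: ('h \<Rightarrow>\<^sub>0 int) \<Rightarrow> real.
    (\<forall>v w. F (v + w) = F v + F w) \<and> (\<forall>v t. (v, t) \<in> K \<longrightarrow> 0 \<le> F v + t)"
  proof (rule additive_functional_nonneg_on)
    fix s :: real assume "0 \<le> s"
    then show "(0, s) \<in> K" unfolding K_def
      by (intro CollectI exI[of _ "{#}"] exI[of _ s]) (simp add: refl)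
  next
    fix z w assume "z \<in> K" "w \<in> K"
    then obtain x y a b t x' y' a' b' t' where
      "z = (formal_sum x - formal_sum y + (formal_sum a - formal_sum b), t)"
      "R a b" "k * N y - N x \<le> t"
      "w = (formal_sum x' - formal_sum y' + (formal_sum a' - formal_sum b'), t')"
      "R a' b'" "k * N y' - N x' \<le> t'"
      unfolding K_def by blast
    then show "z + w \<in> K" unfolding K_def
      by (intro CollectI exI[of _ "x + x'"] exI[of _ "y + y'"] exI[of _ "a + a'"]
          exI[of _ "b + b'"] exI[of _ "t + t'"]) (simp add: add algebra_simps)
  next
    fix s assume "(0, s) \<in> K"
    then obtain x y a b where *: "formal_sum x - formal_sum y + (formal_sum a - formal_sum b) = 0"
      "R a b" "k * N y - N x \<le> s" unfolding K_def by auto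
    have "formal_sum (x + a) = formal_sum (y + b)" using *(1) by (simp add: algebra_simps)
    then have "x + a = y + b" by (rule formal_sum_inj)
    then show "0 \<le> s" using cycle[OF *(2)] *(3) by fastforce
  next
    fix v :: "'h \<Rightarrow>\<^sub>0 int"
    obtain x y where "v = formal_sum x - formal_sum y" using formal_sum_diff_surj by blast
    then have "(v, k * N y - N x) \<in> K" unfolding K_def
      by (intro CollectI exI[of _ x] exI[of _ y] exI[of _ "{#}"] exI[of _ "k * N y - N x"]) (simp add: refl)
    then show "\<exists>t. (v, t) \<in> K" ..
  qed
  then obtain F :: "('h \<Rightarrow>\<^sub>0 int) \<Rightarrow> real" where F_add: "\<And>v w. F (v + w) = F v + F w"
    and F_K: "\<And>v t. (v, t) \<in> K \<Longrightarrow> 0 \<le> F v + t" by blast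
  have F0: "F 0 = 0" using F_add[of 0 0] by simp
  have F_diff: "F (v - w) = F v - F w" for v w using F_add[of "v - w" w] by simp
  define Q where "Q h = F (formal_sum {#h#})" for h
  have F_Q: "F (formal_sum a) = (\<Sum>h\<in>#a. Q h)" for a
    by (induction a) (simp_all add: F0 F_add Q_def formal_sum_def)
  have use: "0 \<le> F (formal_sum x) - F (formal_sum y) + (F (formal_sum a) - F (formal_sum b)) + (k * N y - N x)"
    if "R a b" for x y a b
    using F_K[of "formal_sum x - formal_sum y + (formal_sum a - formal_sum b)" "k * N y - N x"] that
    unfolding K_def by (auto simp: F_add F_diff)
  show ?thesis
  proof (intro exI[of _ Q] conjI allI impI)
    fix h show "n h \<le> Q h" using use[OF refl, of "{#h#}" "{#}" "{#}"] by (simp add: F0 Q_def N_def)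
    show "Q h \<le> k * n h" using use[OF refl, of "{#}" "{#h#}" "{#}"] by (simp add: F0 Q_def N_def)
  next
    fix a b assume "R a b"
    then show "(\<Sum>h\<in>#b. Q h) \<le> (\<Sum>h\<in>#a. Q h)" using use[of a b "{#}" "{#}"] by (simp add: F_Q F0)
  qed
qed

section \<open>Quadratic forms and operators on a Hilbert space\<close>

instance chilbert \<subseteq> banach ..

text \<open>
  The representing vector is the minimizer of \<open>\<parallel>x\<parallel>\<^sup>2 - 2 g x\<close>; minimizing sequences are Cauchy by
  the parallelogram law.
\<close>

lemma riesz_representation:
  fixes g :: "'h::{real_inner,complete_space} \<Rightarrow> real"
  assumes "bounded_linear g"
  shows "\<exists>z. \<forall>x. g x = inner z x"
proof -
  interpret g: bounded_linear g by fact
  obtain B where B: "\<And>x. \<bar>g x\<bar> \<le> norm x * B" using g.bounded by auto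
  define J where "J x = (norm x)\<^sup>2 - 2 * g x" for x
  have lower: "- B\<^sup>2 \<le> J x" for x
  proof -
    have "0 \<le> (norm x - B)\<^sup>2" by simp
    moreover have "g x \<le> norm x * B" using B[of x] by linarith
    ultimately show ?thesis unfolding J_def power2_diff by linarith
  qed
  then have bdd: "bdd_below (range J)" by (intro bdd_belowI2)
  define \<mu> where "\<mu> = (INF x. J x)"
  have \<mu>: "\<mu> \<le> J x" for x unfolding \<mu>_def by (intro cINF_lower bdd) simp
  have mid: "(norm (x - y))\<^sup>2 = 2 * J x + 2 * J y - 4 * J ((1/2) *\<^sub>R (x + y))" for x y
  proof -
    have "(norm ((1/2) *\<^sub>R (x + y)))\<^sup>2 = (norm (x + y))\<^sup>2 / 4" by (simp add: power_divide)
    then show ?thesis unfolding J_def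
      by (simp add: g.scaleR g.add power2_norm_eq_inner inner_add inner_diff inner_commute algebra_simps)
  qed
  have "\<exists>x. J x < \<mu> + 1 / real (Suc n)" for n
    using cInf_lessD[of "range J" "\<mu> + 1 / real (Suc n)"] unfolding \<mu>_def by auto
  then obtain u where u: "\<And>n. J (u n) < \<mu> + 1 / real (Suc n)" by metis
  have near: "(norm (u m - u n))\<^sup>2 \<le> 2 / real (Suc m) + 2 / real (Suc n)" for m n
    using mid[of "u m" "u n"] u[of m] u[of n] \<mu>[of "(1/2) *\<^sub>R (u m + u n)"] by simp
  have "Cauchy u"
  proof (rule metric_CauchyI)
    fix e :: real assume "e > 0"
    then obtain N where N: "1 / real (Suc N) < e\<^sup>2 / 4"
      using nat_approx_posE[of "e\<^sup>2 / 4"] by auto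
    have "dist (u m) (u n) < e" if "m \<ge> N" "n \<ge> N" for m n
    proof -
      have "1 / real (Suc m) \<le> 1 / real (Suc N)" "1 / real (Suc n) \<le> 1 / real (Suc N)"
        using that by (auto intro!: divide_left_mono)
      then have "(norm (u m - u n))\<^sup>2 < e\<^sup>2" using near[of m n] N by simp
      then show ?thesis using \<open>e > 0\<close> by (simp add: dist_norm power2_less_imp_less)
    qed
    then show "\<exists>N. \<forall>m\<ge>N. \<forall>n\<ge>N. dist (u m) (u n) < e" by blast
  qed
  then obtain z where z: "u \<longlonglongrightarrow> z" using Cauchy_convergent convergent_def by blast
  have "(\<lambda>n. J (u n)) \<longlonglongrightarrow> J z"
    unfolding J_def by (intro tendsto_intros z g.tendsto)
  moreover have "(\<lambda>n. \<mu> + 1 / real (Suc n)) \<longlonglongrightarrow> \<mu> + 0"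
    by (intro tendsto_intros LIMSEQ_Suc lim_1_over_n)
  ultimately have "J z \<le> \<mu> + 0"
    using u by (intro LIMSEQ_le) (auto intro: less_imp_le)
  then have min: "J z \<le> J x" for x using \<mu>[of x] by simp
  have "g x = inner z x" for x
  proof -
    have q: "0 \<le> 2 * t * (inner z x - g x) + t\<^sup>2 * (norm x)\<^sup>2" for t
      using min[of "z + t *\<^sub>R x"] unfolding J_def power2_norm_eq_inner
      by (simp add: g.scaleR g.add inner_add inner_commute power2_eq_square algebra_simps)
    show ?thesis
    proof (cases "x = 0")
      case True then show ?thesis by (simp add: g.zero)
    next
      case False
      define d where "d = inner z x - g x"
      \<comment> \<open>The value of \<open>t\<close> that minimizes the quadratic polynomial.\<close>
      have "0 \<le> 2 * (- d / (norm x)\<^sup>2) * d + (- d / (norm x)\<^sup>2)\<^sup>2 * (norm x)\<^sup>2"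
        using q[of "- d / (norm x)\<^sup>2"] by (simp add: d_def)
      also have "\<dots> = - d\<^sup>2 / (norm x)\<^sup>2"
        using False by (simp add: power2_eq_square field_simps)
      finally have "d = 0" using False by (simp add: field_simps)
      then show ?thesis by (simp add: d_def)
    qed
  qed
  then show ?thesis by blast
qed

text \<open>
  The deviation of \<open>f\<close> from linearity is additive and has period 1, so it is bounded on the whole
  line; a bounded additive function vanishes.
\<close>

lemma additive_bounded_real_eq_linear:
  fixes f :: "real \<Rightarrow> real"
  assumes add: "\<And>s t. f (s + t) = f s + f t"
    and bounded: "\<And>t. 0 \<le> t \<Longrightarrow> t \<le> 1 \<Longrightarrow> \<bar>f t\<bar> \<le> b"
  shows "f t = t * f 1"
proof -
  define e where "e t = f t - t * f 1" for t
  have e_add: "e (s + t) = e s + e t" for s t by (simp add: e_def add algebra_simps)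
  have e1: "e 1 = 0" by (simp add: e_def)
  have e0: "e 0 = 0" using e_add[of 0 0] by simp
  have e_minus: "e (- t) = - e t" for t using e_add[of t "- t"] e0 by simp
  have e_nat: "e (real n * t) = real n * e t" for n t
    by (induction n) (simp_all add: e0 e_add algebra_simps)
  have e_int: "e (of_int m) = 0" for m :: int
    using e_nat[of "nat m" 1] e_nat[of "nat (- m)" 1] e_minus[of "of_int m"] e1
    by (cases "m \<ge> 0") auto
  have e_bound: "\<bar>e t\<bar> \<le> b + \<bar>f 1\<bar>" for t
  proof -
    have "e t = e (frac t)" using e_add[of "frac t" "of_int \<lfloor>t\<rfloor>"] e_int by (simp add: frac_def)
    moreover have "\<bar>f (frac t)\<bar> \<le> b" using frac_lt_1[of t] by (intro bounded) auto
    moreover have "\<bar>frac t * f 1\<bar> \<le> 1 * \<bar>f 1\<bar>"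
      unfolding abs_mult using frac_lt_1[of t] by (intro mult_right_mono) auto
    ultimately show ?thesis unfolding e_def by linarith
  qed
  have "real n * \<bar>e t\<bar> \<le> b + \<bar>f 1\<bar>" for n
    using e_bound[of "real n * t"] by (simp add: e_nat abs_mult)
  then have "\<bar>e t\<bar> \<le> 0" by (meson ex_less_of_nat_mult not_le)
  then show ?thesis by (simp add: e_def)
qed

text \<open>
  The theorem of Jordan and von Neumann.  Biadditivity comes from the parallelogram law; the
  two-sided bound on \<open>Q\<close> replaces continuity in the step to real scalars.
\<close>

lemma parallelogram_imp_bilinear:
  fixes Q :: "'a::real_normed_vector \<Rightarrow> real"
  assumes par: "\<And>x y. Q (x + y) + Q (x - y) = 2 * Q x + 2 * Q y"
    and nonneg: "\<And>x. 0 \<le> Q x" and bound: "\<And>x. Q x \<le> k * (norm x)\<^sup>2" and k: "0 \<le> k"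
  defines "B \<equiv> \<lambda>x y. (Q (x + y) - Q (x - y)) / 4"
  shows "bounded_bilinear B" and "B x x = Q x" and "B x y = B y x"
proof -
  have Q0: "Q 0 = 0" using par[of 0 0] by simp
  have even: "Q (- x) = Q x" for x using par[of 0 x] Q0 by simp
  have Q_commute: "Q (x - y) = Q (y - x)" for x y using even[of "x - y"] by simp
  have sym: "B x y = B y x" for x y unfolding B_def using Q_commute[of x y] by (simp add: add.commute)
  have diag: "B x x = Q x" for x unfolding B_def using par[of x x] Q0 by simp
  have B0: "B 0 y = 0" for y unfolding B_def using even[of y] by simp
  have sum2: "B (u + v) z + B (u - v) z = 2 * B u z" for u v z
  proof -
    have e: "u + v + z = u + z + v" "u + v - z = u - z + v" "u - v + z = u + z - v" "u - v - z = u - z - v"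
      by (simp_all add: algebra_simps)
    show ?thesis unfolding B_def e using par[of "u + z" v] par[of "u - z" v] by (simp add: field_simps)
  qed
  have double: "B (u + u) z = 2 * B u z" for u z using sum2[of u u z] B0 by simp
  have addl: "B (x + y) z = B x z + B y z" for x y z
  proof -
    define u v where "u = (1/2) *\<^sub>R (x + y)" and "v = (1/2) *\<^sub>R (x - y)"
    have eqs: "u + v = x" "u - v = y" "u + u = x + y"
      unfolding u_def v_def by (simp_all add: algebra_simps flip: scaleR_add_left)
    show ?thesis using sum2[of u v z] double[of u z] unfolding eqs by simp
  qed
  have crude: "\<bar>B x y\<bar> \<le> k * ((norm x)\<^sup>2 + (norm y)\<^sup>2) / 2" for x y
  proof -
    have "\<bar>B x y\<bar> \<le> (Q (x + y) + Q (x - y)) / 4"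
      unfolding B_def abs_le_iff using nonneg[of "x + y"] nonneg[of "x - y"] by (simp add: field_simps)
    also have "\<dots> = (Q x + Q y) / 2" using par[of x y] by simp
    also have "\<dots> \<le> k * ((norm x)\<^sup>2 + (norm y)\<^sup>2) / 2"
      using bound[of x] bound[of y] by (simp add: algebra_simps)
    finally show ?thesis .
  qed
  have scale: "B (t *\<^sub>R x) y = t * B x y" for t x y
  proof -
    have "\<bar>B (s *\<^sub>R x) y\<bar> \<le> k * ((norm x)\<^sup>2 + (norm y)\<^sup>2) / 2" if "0 \<le> s" "s \<le> 1" for s
    proof -
      have "norm (s *\<^sub>R x) \<le> norm x" using that mult_right_mono[of s 1 "norm x"] by simp
      then have "(norm (s *\<^sub>R x))\<^sup>2 \<le> (norm x)\<^sup>2" by (intro power_mono) auto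
      then have "k * ((norm (s *\<^sub>R x))\<^sup>2 + (norm y)\<^sup>2) \<le> k * ((norm x)\<^sup>2 + (norm y)\<^sup>2)"
        using k by (intro mult_left_mono) auto
      then show ?thesis using crude[of "s *\<^sub>R x" y] by simp
    qed
    from additive_bounded_real_eq_linear[of "\<lambda>s. B (s *\<^sub>R x) y", OF _ this, of t]
    show ?thesis by (simp add: scaleR_add_left addl)
  qed
  have scale_r: "B x (t *\<^sub>R y) = t * B x y" for t x y using scale sym by metis
  have addr: "B x (y + z) = B x y + B x z" for x y z using addl sym by metis
  \<comment> \<open>The crude bound becomes the sharp one after normalizing both arguments.\<close>
  have fine: "\<bar>B x y\<bar> \<le> k * (norm x * norm y)" for x y
  proof (cases "x = 0 \<or> y = 0")
    case True
    then show ?thesis using B0 sym[of x 0] by auto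
  next
    case False
    then have "\<bar>B (x /\<^sub>R norm x) (y /\<^sub>R norm y)\<bar> \<le> k"
      using crude[of "x /\<^sub>R norm x" "y /\<^sub>R norm y"] by simp
    then have "\<bar>B x y\<bar> / (norm x * norm y) \<le> k"
      by (simp add: scale scale_r abs_mult divide_inverse mult_ac)
    then show ?thesis using False by (simp add: divide_le_eq)
  qed
  show "bounded_bilinear B"
    by (rule bounded_bilinear.intro)
      (use fine in \<open>auto simp: addl addr scale scale_r intro!: exI[of _ k] simp: mult_ac\<close>)
  show "B x x = Q x" "B x y = B y x" by (fact diag sym)+
qed

lemma bilinear_form_operator:
  fixes B :: "'h::{real_inner,complete_space} \<Rightarrow> 'h \<Rightarrow> real"
  assumes "bounded_bilinear B" 
  shows "\<exists>T :: 'h \<Rightarrow>\<^sub>L 'h. \<forall>x y. B x y = inner (blinfun_apply T x) y"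
proof -
  interpret B: bounded_bilinear B by fact
  have "\<exists>z. \<forall>y. B x y = inner z y" for x
    by (rule riesz_representation) (rule B.bounded_linear_right)
  then obtain T where T: "\<And>x y. B x y = inner (T x) y" by metis
  obtain b where b: "b \<ge> 0" "\<And>x y. \<bar>B x y\<bar> \<le> norm x * norm y * b" using B.nonneg_bounded by auto
  have eqI: "u = v" if "\<And>y. inner u y = inner v y" for u v :: 'h
  proof -
    have "inner (u - v) (u - v) = 0" using that[of "u - v"] by (simp add: inner_diff_left)
    then show ?thesis by simp
  qed
  have "bounded_linear T"
  proof (rule bounded_linear_intro[where K = b])
    show "T (x + y) = T x + T y" for x y
      by (rule eqI) (simp add: inner_add_left B.add_left flip: T)
    show "T (r *\<^sub>R x) = r *\<^sub>R T x" for r x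
      by (rule eqI) (simp add: B.scaleR_left flip: T)
    show "norm (T x) \<le> norm x * b" for x
    proof (cases "T x = 0")
      case False
      have "norm (T x) * norm (T x) = B x (T x)" by (simp add: T power2_norm_eq_inner[symmetric] power2_eq_square)
      also have "\<dots> \<le> norm x * b * norm (T x)" using b(2)[of x "T x"] by (simp add: mult_ac)
      finally show ?thesis using False by simp
    qed (use b in simp)
  qed
  then have "\<forall>x y. B x y = inner (blinfun_apply (Blinfun T) x) y"
    by (simp add: bounded_linear_Blinfun_apply T)
  then show ?thesis by blast
qed

text \<open>
  Polarization: for \<open>y\<close> parallel to \<open>D x\<close> and of the same length as \<open>x\<close>, the number \<open>4 \<langle>D x, y\<rangle>\<close> is a
  difference of two values of the quadratic form.
\<close>

lemma norm_le_of_quadratic_form: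
  fixes D :: "'h::real_inner \<Rightarrow>\<^sub>L 'h"
  assumes sym: "\<And>x y. inner (D x) y = inner x (D y)"
    and bound: "\<And>x. \<bar>inner (D x) x\<bar> \<le> r * (norm x)\<^sup>2"  and r: "0 \<le> r"
  shows "norm D \<le> r"
proof (rule norm_blinfun_bound[OF r])
  fix x
  show "norm (D x) \<le> r * norm x"
  proof (cases "D x = 0 \<or> x = 0")
    case False
    define a where "a = norm x / norm (D x)"
    define y where "y = a *\<^sub>R D x"
    have ny: "norm y = norm x" using False by (simp add: y_def a_def)
    have "4 * inner (D x) y = inner (D (x + y)) (x + y) - inner (D (x - y)) (x - y)"
      using sym[of x y] sym[of y x]
      by (simp add: blinfun.add_right blinfun.diff_right inner_add inner_diff inner_commute)
    also have "\<dots> \<le> r * (norm (x + y))\<^sup>2 + r * (norm (x - y))\<^sup>2"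
      using bound[of "x + y"] bound[of "x - y"] by linarith
    also have "\<dots> = r * (2 * (norm x)\<^sup>2 + 2 * (norm y)\<^sup>2)"
      by (simp add: power2_norm_eq_inner inner_add inner_diff inner_commute algebra_simps)
    finally have "inner (D x) y \<le> r * (norm x)\<^sup>2" by (simp add: ny)
    moreover have "inner (D x) y = norm x * norm (D x)"
      using False by (simp add: y_def a_def power2_norm_eq_inner[symmetric] power2_eq_square)
    ultimately have "norm x * norm (D x) \<le> norm x * (r * norm x)" by (simp add: power2_eq_square mult_ac)
    then show ?thesis using False by simp
  qed (use r in auto)
qed

lemma BH_closure:
  shows "id_blinfun \<in> BH" "S \<in> BH \<Longrightarrow> T \<in> BH \<Longrightarrow> S + T \<in> BH"
    "S \<in> BH \<Longrightarrow> T \<in> BH \<Longrightarrow> S - T \<in> BH" "S \<in> BH \<Longrightarrow> r *\<^sub>R S \<in> BH"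
    "S \<in> BH \<Longrightarrow> T \<in> BH \<Longrightarrow> S o\<^sub>L T \<in> BH"
  by (auto simp: BH_def blinfun.add_left blinfun.diff_left blinfun.scaleR_left scaleC_add_right
      scaleR_scaleC scaleC_scaleC mult.commute linear_diff[OF bounded_linear.linear[OF bounded_linear_scaleC]])

lemma closed_BH: "closed (BH :: ('h::chilbert \<Rightarrow>\<^sub>L 'h) set)"
proof -
  have "BH = (\<Inter>c x. {T :: 'h \<Rightarrow>\<^sub>L 'h. T (scaleC c x) = scaleC c (T x)})"
    by (auto simp: BH_def)
  also have "closed \<dots>"
    by (intro closed_INT ballI closed_Collect_eq
        continuous_on_compose2[OF linear_continuous_on[OF bounded_linear_scaleC]] continuous_intros) auto
  finally show ?thesis .
qed

lemma blinfun_compose_diff: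
  "(S - T) o\<^sub>L U = (S o\<^sub>L U) - (T o\<^sub>L U)" "U o\<^sub>L (S - T) = (U o\<^sub>L S) - (U o\<^sub>L T)"
  by (auto intro!: blinfun_eqI simp: blinfun.diff_left blinfun.diff_right)

lemma blinfun_compose_id: "id_blinfun o\<^sub>L S = S" "S o\<^sub>L id_blinfun = S"
  by (auto intro!: blinfun_eqI)

lemma blinfun_compose_assoc: "(S o\<^sub>L T) o\<^sub>L U = S o\<^sub>L (T o\<^sub>L U)"
  by (auto intro!: blinfun_eqI)

text \<open>
  Both one-sided inverses are fixed points of contractions, \<open>Z \<mapsto> 1 + Y Z\<close> and \<open>Z \<mapsto> 1 + Z Y\<close>,
  which take the place of the Neumann series.
\<close>

lemma inverse_pair_one_minus:
  fixes Y :: "'h::chilbert \<Rightarrow>\<^sub>L 'h"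
  assumes Y: "Y \<in> BH" "norm Y < 1"
  shows "\<exists>Z. inverse_pair (id_blinfun - Y) Z"
proof -
  have d: "dist (id_blinfun + (Y o\<^sub>L S)) (id_blinfun + (Y o\<^sub>L T)) \<le> norm Y * dist S T" for S T :: "'h \<Rightarrow>\<^sub>L 'h"
    using norm_blinfun_compose[of Y "S - T"] by (simp add: dist_norm blinfun_compose_diff)
  have d': "dist (id_blinfun + (S o\<^sub>L Y)) (id_blinfun + (T o\<^sub>L Y)) \<le> norm Y * dist S T" for S T :: "'h \<Rightarrow>\<^sub>L 'h"
    using norm_blinfun_compose[of "S - T" Y] by (simp add: dist_norm blinfun_compose_diff mult.commute)
  have compl: "complete (BH :: ('h \<Rightarrow>\<^sub>L 'h) set)" using closed_BH by (simp add: complete_eq_closed)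
  have "\<exists>!Z\<in>BH. id_blinfun + (Y o\<^sub>L Z) = Z"
    by (rule Banach_fix[OF compl _ norm_ge_zero Y(2)]) (use BH_closure(1) Y d in \<open>auto intro!: BH_closure(2,5)\<close>)
  then obtain Z where Z: "Z \<in> BH" "id_blinfun + (Y o\<^sub>L Z) = Z" by blast
  have "\<exists>!Z\<in>BH. id_blinfun + (Z o\<^sub>L Y) = Z"
    by (rule Banach_fix[OF compl _ norm_ge_zero Y(2)]) (use BH_closure(1) Y d' in \<open>auto intro!: BH_closure(2,5)\<close>)
  then obtain Z' where Z': "Z' \<in> BH" "id_blinfun + (Z' o\<^sub>L Y) = Z'" by blast
  have r: "(id_blinfun - Y) o\<^sub>L Z = id_blinfun" using Z(2) by (simp add: blinfun_compose_diff algebra_simps blinfun_compose_id)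
  have l: "Z' o\<^sub>L (id_blinfun - Y) = id_blinfun" using Z'(2) by (simp add: blinfun_compose_diff algebra_simps blinfun_compose_id)
  have "Z' = Z" using l r by (metis blinfun_compose_assoc blinfun_compose_id)
  then have "inverse_pair (id_blinfun - Y) Z"
    using l r Z Y BH_closure by (auto simp: inverse_pair_def)
  then show ?thesis ..
qed

text \<open>
  \<open>X\<close> is the square root of \<open>1 - D\<close>.  Writing \<open>X = 1 - Y\<close> turns \<open>X\<^sup>2 = 1 - D\<close> into the fixed point
  equation \<open>Y = (D + Y\<^sup>2) / 2\<close>, which is a contraction of a ball of radius less than 1 among the
  self-adjoint complex-linear operators.
\<close>

lemma sqrt_one_minus:
  fixes D :: "'h::chilbert \<Rightarrow>\<^sub>L 'h"
  assumes D: "D \<in> BH" "norm D < 1" and sym: "\<And>x y. inner (D x) y = inner x (D y)"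
  shows "\<exists>X X'. inverse_pair X X' \<and> (\<forall>x. (norm (X x))\<^sup>2 = (norm x)\<^sup>2 - inner (D x) x)"
proof -
  \<comment> \<open>The scalar fixed point \<open>r = (\<parallel>D\<parallel> + r\<^sup>2) / 2\<close>: the ball of this radius is mapped to itself,
    and \<open>r < 1\<close> is the contraction constant.\<close>
  define r where "r = 1 - sqrt (1 - norm D)"
  have r: "0 \<le> r" "r < 1" unfolding r_def using D by auto
  have rr: "norm D + r * r = 2 * r"
    using D(2) real_sqrt_pow2[of "1 - norm D"] unfolding r_def by (simp add: power2_eq_square algebra_simps)
  define \<S> where "\<S> = BH \<inter> {Y :: 'h \<Rightarrow>\<^sub>L 'h. norm Y \<le> r} \<inter> {Y :: 'h \<Rightarrow>\<^sub>L 'h. \<forall>x y. inner (Y x) y = inner x (Y y)}"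
  define f where "f Y = (1/2) *\<^sub>R (D + (Y o\<^sub>L Y))" for Y
  have "closed {Y :: 'h \<Rightarrow>\<^sub>L 'h. \<forall>x y. inner (Y x) y = inner x (Y y)}"
    unfolding Collect_all_eq by (intro closed_INT ballI closed_Collect_eq continuous_intros)
  moreover have "closed {Y :: 'h \<Rightarrow>\<^sub>L 'h. norm Y \<le> r}"
    by (intro closed_Collect_le continuous_intros)
  ultimately have "complete \<S>" unfolding \<S>_def complete_eq_closed by (intro closed_Int closed_BH)
  moreover have "0 \<in> \<S>" unfolding \<S>_def BH_def using r
    by (simp add: linear_0[OF bounded_linear.linear[OF bounded_linear_scaleC]])
  moreover have "f ` \<S> \<subseteq> \<S>"
  proof
    fix Z assume "Z \<in> f ` \<S>"
    then obtain Y where Y: "Y \<in> BH" "norm Y \<le> r" "\<And>x y. inner (Y x) y = inner x (Y y)" and Z: "Z = f Y"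
      unfolding \<S>_def by blast
    have "norm (Y o\<^sub>L Y) \<le> r * r"
      using norm_blinfun_compose[of Y Y] mult_mono[OF Y(2) Y(2)] r by simp
    then have "norm Z \<le> r"
      unfolding Z f_def using norm_triangle_ineq[of D "Y o\<^sub>L Y"] rr by simp
    moreover have "Z \<in> BH" unfolding Z f_def by (intro BH_closure D Y)
    ultimately show "Z \<in> \<S>"
      unfolding \<S>_def by (simp add: Z f_def blinfun.add_left blinfun.scaleR_left inner_add Y(3) sym)
  qed
  moreover have "dist (f Y) (f Z) \<le> r * dist Y Z" if "Y \<in> \<S>" "Z \<in> \<S>" for Y Z
  proof -
    have n: "norm Y \<le> r" "norm Z \<le> r" using that by (auto simp: \<S>_def)
    have "f Y - f Z = (1/2) *\<^sub>R ((Y o\<^sub>L (Y - Z)) + ((Y - Z) o\<^sub>L Z))"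
      unfolding f_def by (simp add: blinfun_compose_diff algebra_simps)
    then have "norm (f Y - f Z) \<le> (norm Y * norm (Y - Z) + norm (Y - Z) * norm Z) / 2"
      using norm_triangle_ineq[of "Y o\<^sub>L (Y - Z)" "(Y - Z) o\<^sub>L Z"]
        norm_blinfun_compose[of Y "Y - Z"] norm_blinfun_compose[of "Y - Z" Z] by simp
    also have "\<dots> \<le> (r * norm (Y - Z) + norm (Y - Z) * r) / 2"
      using n by (intro divide_right_mono add_mono mult_right_mono mult_left_mono) auto
    finally show ?thesis by (simp add: dist_norm)
  qed
  ultimately have "\<exists>!Y\<in>\<S>. f Y = Y" by (intro Banach_fix[OF _ _ r]) auto
  then obtain Y where YS: "Y \<in> \<S>" and fix_Y: "f Y = Y" by blast
  then have Y: "Y \<in> BH" "norm Y < 1" "\<And>x y. inner (Y x) y = inner x (Y y)" using r by (auto simp: \<S>_def)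
  have "2 *\<^sub>R Y = D + (Y o\<^sub>L Y)" using fix_Y unfolding f_def
    by (metis scaleR_half_double scaleR_2 scaleR_add_right)
  then have YY: "Y (Y x) = 2 *\<^sub>R Y x - D x" for x
    by (metis add_diff_cancel_left' blinfun.add_left blinfun.scaleR_left blinfun_apply_blinfun_compose)
  have "(norm ((id_blinfun - Y) x))\<^sup>2 = (norm x)\<^sup>2 - inner (D x) x" for x
  proof -
    have "inner (Y x) (Y x) = 2 * inner (Y x) x - inner (D x) x"
      by (metis Y(3) YY inner_diff_left inner_scaleR_left)
    then show ?thesis
      by (simp add: power2_norm_eq_inner blinfun.diff_left inner_diff inner_commute)
  qed
  then show ?thesis using inverse_pair_one_minus[OF Y(1,2)] by blast
qed

section \<open>Norms of operator matrices\<close>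

lemma vec_norm_sq: "(vec_norm d x)\<^sup>2 = (\<Sum>i<d. (norm (x i))\<^sup>2)"
  unfolding vec_norm_def L2_set_def by (simp add: sum_nonneg)

lemma vec_norm_nonneg: "0 \<le> vec_norm d x" by (simp add: vec_norm_def)

lemma vec_norm_cong: "(\<And>i. i < d \<Longrightarrow> x i = y i) \<Longrightarrow> vec_norm d x = vec_norm d y"
  unfolding vec_norm_def by (intro L2_set_cong) auto

lemma vec_norm_scaleR: "vec_norm d (\<lambda>i. r *\<^sub>R x i) = \<bar>r\<bar> * vec_norm d x"
  by (rule power2_eq_imp_eq) (simp_all add: vec_norm_sq vec_norm_nonneg power_mult_distrib sum_distrib_left)

lemma mat_apply_cong:
  "(\<And>i j. i < d \<Longrightarrow> j < d \<Longrightarrow> a i j = b i j) \<Longrightarrow> (\<And>j. j < d \<Longrightarrow> x j = y j) \<Longrightarrow> i < d \<Longrightarrow>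
    mat_apply d a x i = mat_apply d b y i"
  unfolding mat_apply_def by (intro sum.cong) auto

lemma mat_apply_scaleR: "mat_apply d a (\<lambda>i. r *\<^sub>R x i) = (\<lambda>i. r *\<^sub>R mat_apply d a x i)"
  by (simp add: mat_apply_def blinfun.scaleR_right scaleR_sum_right)

lemma matnorm_cong:
  assumes "\<And>i j. i < d \<Longrightarrow> j < d \<Longrightarrow> a i j = b i j"
  shows "matnorm d a = matnorm d b"
  unfolding matnorm_def using assms
  by (intro SUP_cong refl vec_norm_cong mat_apply_cong) auto

lemma matnorm_nonneg: "0 \<le> matnorm d a"
  unfolding matnorm_def
  by (rule cSUP_upper2[OF matnorm_bdd_above matnorm_dom_nonempty]) (simp add: vec_norm_nonneg)

lemma vec_norm_mat_apply_le: "vec_norm d (mat_apply d a x) \<le> matnorm d a * vec_norm d x"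
proof (cases "vec_norm d x = 0")
  case True
  then have "(vec_norm d x)\<^sup>2 = 0" by simp
  then have "x i = 0" if "i < d" for i
    unfolding vec_norm_sq using that by (subst (asm) sum_nonneg_eq_0_iff) auto
  then have "vec_norm d (mat_apply d a x) = vec_norm d (\<lambda>_. 0 :: 'a)"
    by (intro vec_norm_cong) (simp add: mat_apply_def)
  then show ?thesis using True by (simp add: vec_norm_def L2_set_0')
next
  case False
  define r where "r = vec_norm d x"
  have r: "r > 0" using False vec_norm_nonneg[of d x] by (simp add: r_def)
  have "vec_norm d (\<lambda>i. (1/r) *\<^sub>R x i) \<le> 1" using r by (simp add: vec_norm_scaleR flip: r_def)
  then have "vec_norm d (mat_apply d a (\<lambda>i. (1/r) *\<^sub>R x i)) \<le> matnorm d a"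
    unfolding matnorm_def by (intro cSUP_upper matnorm_bdd_above) simp
  then have "vec_norm d (mat_apply d a x) / r \<le> matnorm d a"
    using r by (simp add: mat_apply_scaleR vec_norm_scaleR)
  then show ?thesis using r by (simp add: divide_le_eq flip: r_def)
qed

lemma matnorm_leI:
  assumes "\<And>x. vec_norm d (mat_apply d a x) \<le> M * vec_norm d x" and "0 \<le> M"
  shows "matnorm d a \<le> M"
  unfolding matnorm_def
proof (rule cSUP_least)
  show "{x :: nat \<Rightarrow> 'a. vec_norm d x \<le> 1} \<noteq> {}" using matnorm_dom_nonempty by blast
  fix x :: "nat \<Rightarrow> 'a" assume "x \<in> {x. vec_norm d x \<le> 1}"
  then have "M * vec_norm d x \<le> M * 1" using assms(2) by (intro mult_left_mono) auto
  then show "vec_norm d (mat_apply d a x) \<le> M" using assms(1)[of x] by linarith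
qed

definition mat_mul :: "nat \<Rightarrow> (nat \<Rightarrow> nat \<Rightarrow> ('a::chilbert \<Rightarrow>\<^sub>L 'a)) \<Rightarrow> (nat \<Rightarrow> nat \<Rightarrow> ('a \<Rightarrow>\<^sub>L 'a))
    \<Rightarrow> nat \<Rightarrow> nat \<Rightarrow> ('a \<Rightarrow>\<^sub>L 'a)" where
  "mat_mul d a b = (\<lambda>i j. \<Sum>k<d. a i k o\<^sub>L b k j)"

lemma mat_apply_mul: "mat_apply d (mat_mul d a b) x = mat_apply d a (mat_apply d b x)"
proof
  fix i
  have "mat_apply d (mat_mul d a b) x i = (\<Sum>j<d. \<Sum>k<d. a i k (b k j (x j)))"
    by (simp add: mat_apply_def mat_mul_def blinfun.sum_left)
  also have "\<dots> = (\<Sum>k<d. \<Sum>j<d. a i k (b k j (x j)))" by (rule sum.swap)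
  also have "\<dots> = mat_apply d a (mat_apply d b x) i" by (simp add: mat_apply_def blinfun.sum_right)
  finally show "mat_apply d (mat_mul d a b) x i = mat_apply d a (mat_apply d b x) i" .
qed

lemma matnorm_mul_le: "matnorm d (mat_mul d a b) \<le> matnorm d a * matnorm d b"
proof (rule matnorm_leI)
  fix x :: "nat \<Rightarrow> 'a"
  have "vec_norm d (mat_apply d (mat_mul d a b) x) \<le> matnorm d a * vec_norm d (mat_apply d b x)"
    unfolding mat_apply_mul by (rule vec_norm_mat_apply_le)
  also have "\<dots> \<le> matnorm d a * (matnorm d b * vec_norm d x)"
    by (intro mult_left_mono vec_norm_mat_apply_le matnorm_nonneg)
  finally show "vec_norm d (mat_apply d (mat_mul d a b) x) \<le> matnorm d a * matnorm d b * vec_norm d x"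
    by (simp add: mult_ac)
qed (simp add: matnorm_nonneg)

definition mat_sum :: "nat \<Rightarrow> (nat \<Rightarrow> nat \<Rightarrow> ('a::chilbert \<Rightarrow>\<^sub>L 'a)) \<Rightarrow> (nat \<Rightarrow> nat \<Rightarrow> ('a \<Rightarrow>\<^sub>L 'a))
    \<Rightarrow> nat \<Rightarrow> nat \<Rightarrow> ('a \<Rightarrow>\<^sub>L 'a)" where
  "mat_sum d a b = (\<lambda>i j. if i < d \<and> j < d then a i j
     else if d \<le> i \<and> d \<le> j then b (i - d) (j - d) else 0)"

definition vec_append :: "nat \<Rightarrow> (nat \<Rightarrow> 'a) \<Rightarrow> (nat \<Rightarrow> 'a) \<Rightarrow> nat \<Rightarrow> 'a" where
  "vec_append d x y = (\<lambda>i. if i < d then x i else y (i - d))"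

lemma sum_lessThan_add: "(\<Sum>i<d + e. f i) = (\<Sum>i<d. f i) + (\<Sum>i<e. f (d + i))" for f :: "nat \<Rightarrow> 'a::comm_monoid_add"
  by (induction e) (simp_all add: add.assoc)

lemma vec_norm_append:
  "(vec_norm (d + e) x)\<^sup>2 = (vec_norm d x)\<^sup>2 + (vec_norm e (\<lambda>i. x (d + i)))\<^sup>2"
  by (simp add: vec_norm_sq sum_lessThan_add)

lemma mat_apply_sum:
  "i < d \<Longrightarrow> mat_apply (d + e) (mat_sum d a b) x i = mat_apply d a x i"
  "mat_apply (d + e) (mat_sum d a b) x (d + i) = mat_apply e b (\<lambda>j. x (d + j)) i"
  by (simp_all add: mat_apply_def mat_sum_def sum_lessThan_add)

lemma matnorm_sum_le1:
  assumes "matnorm d a \<le> 1" "matnorm e b \<le> 1"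
  shows "matnorm (d + e) (mat_sum d a b) \<le> 1"
proof (rule matnorm_leI)
  fix x :: "nat \<Rightarrow> 'a"
  let ?y = "\<lambda>j. x (d + j)"
  have "(vec_norm (d + e) (mat_apply (d + e) (mat_sum d a b) x))\<^sup>2
      = (vec_norm d (mat_apply d a x))\<^sup>2 + (vec_norm e (mat_apply e b ?y))\<^sup>2"
    unfolding vec_norm_append by (simp add: mat_apply_sum cong: vec_norm_cong)
  also have "\<dots> \<le> (vec_norm d x)\<^sup>2 + (vec_norm e ?y)\<^sup>2"
  proof (intro add_mono power_mono vec_norm_nonneg)
    show "vec_norm d (mat_apply d a x) \<le> vec_norm d x"
      using vec_norm_mat_apply_le[of d a x] mult_right_mono[OF assms(1) vec_norm_nonneg[of d x]] by simp
    show "vec_norm e (mat_apply e b ?y) \<le> vec_norm e ?y"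
      using vec_norm_mat_apply_le[of e b ?y] mult_right_mono[OF assms(2) vec_norm_nonneg[of e ?y]] by simp
  qed
  also have "\<dots> = (vec_norm (d + e) x)\<^sup>2" by (simp add: vec_norm_append)
  finally show "vec_norm (d + e) (mat_apply (d + e) (mat_sum d a b) x) \<le> 1 * vec_norm (d + e) x"
    unfolding mult_1 by (rule power2_le_imp_le) (rule vec_norm_nonneg)
qed simp

lemma op_scale_0 [simp]: "op_scale 0 T = 0"
  by (rule blinfun_eqI) (use norm_scaleC[of 0] in simp)

lemma op_scale_of_real: "op_scale (of_real r) T = r *\<^sub>R T"
  by (intro blinfun_eqI) (simp add: scaleR_scaleC blinfun.scaleR_left)

section \<open>Domination of finite families of vectors\<close>

locale operator_algebra_hom =
  fixes C :: "('k::chilbert \<Rightarrow>\<^sub>L 'k) set" and \<rho> :: "('k \<Rightarrow>\<^sub>L 'k) \<Rightarrow> ('h::chilbert \<Rightarrow>\<^sub>L 'h)"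
  assumes algebra: "unital_operator_algebra C"
    and linear: "op_linear_on C \<rho>"
    and unital: "\<rho> id_blinfun = id_blinfun"
    and mult: "S \<in> C \<Longrightarrow> T \<in> C \<Longrightarrow> \<rho> (S o\<^sub>L T) = \<rho> S o\<^sub>L \<rho> T"
begin

lemma C_closed: "id_blinfun \<in> C" "S \<in> C \<Longrightarrow> T \<in> C \<Longrightarrow> S + T \<in> C" "S \<in> C \<Longrightarrow> T \<in> C \<Longrightarrow> S o\<^sub>L T \<in> C"
  "S \<in> C \<Longrightarrow> op_scale c S \<in> C" "0 \<in> C"
proof -
  show *: "id_blinfun \<in> C" "S \<in> C \<Longrightarrow> T \<in> C \<Longrightarrow> S + T \<in> C" "S \<in> C \<Longrightarrow> T \<in> C \<Longrightarrow> S o\<^sub>L T \<in> C"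
    "S \<in> C \<Longrightarrow> op_scale c S \<in> C" for S T c
    using algebra unfolding unital_operator_algebra_def by blast+
  show "0 \<in> C" using *(4)[OF *(1), of 0] by simp
qed

lemma \<rho>_linear: "S \<in> C \<Longrightarrow> T \<in> C \<Longrightarrow> \<rho> (S + T) = \<rho> S + \<rho> T" "S \<in> C \<Longrightarrow> \<rho> (op_scale c S) = op_scale c (\<rho> S)"
  "\<rho> 0 = 0"
proof -
  show "S \<in> C \<Longrightarrow> T \<in> C \<Longrightarrow> \<rho> (S + T) = \<rho> S + \<rho> T" and *: "S \<in> C \<Longrightarrow> \<rho> (op_scale c S) = op_scale c (\<rho> S)" for S T c
    using linear unfolding op_linear_on_def by blast+
  show "\<rho> 0 = 0" using *[OF C_closed(1), of 0] by simp
qed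

lemma sum_C: "(\<And>i. i \<in> I \<Longrightarrow> f i \<in> C) \<Longrightarrow> (\<Sum>i\<in>I. f i) \<in> C \<and> \<rho> (\<Sum>i\<in>I. f i) = (\<Sum>i\<in>I. \<rho> (f i))"
  by (induction I rule: infinite_finite_induct) (auto simp: C_closed \<rho>_linear)

lemma mat_mul_C:
  assumes "a \<in> mats_over d C" "b \<in> mats_over d C"
  shows "mat_mul d a b \<in> mats_over d C"
    and "i < d \<Longrightarrow> j < d \<Longrightarrow> \<rho> (mat_mul d a b i j) = mat_mul d (\<lambda>i j. \<rho> (a i j)) (\<lambda>i j. \<rho> (b i j)) i j"
  using assms sum_C[of "{..<d}"] by (auto simp: mats_over_def mat_mul_def C_closed mult)

definition tuple_mset :: "nat \<Rightarrow> (nat \<Rightarrow> 'x) \<Rightarrow> 'x multiset" where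
  "tuple_mset d u = image_mset u (mset_set {..<d})"

text \<open>
  Multisets make the direct sum of families a commutative addition and hide all reordering of
  coordinates; the tuples are coordinates for the two multisets.
\<close>

definition dominates :: "'h multiset \<Rightarrow> 'h multiset \<Rightarrow> bool" where
  "dominates U W \<longleftrightarrow> (\<exists>d u w a. U = tuple_mset d u \<and> W = tuple_mset d w \<and> a \<in> mats_over d C \<and>
     matnorm d a \<le> 1 \<and> (\<forall>i<d. w i = mat_apply d (\<lambda>i j. \<rho> (a i j)) u i))"

lemma tuple_mset_perm:
  assumes "tuple_mset d u = tuple_mset e v"
  shows "d = e \<and> (\<exists>p. p permutes {..<d} \<and> (\<forall>i<d. u i = v (p i)))"
proof -
  have s: "size (tuple_mset d u) = d" for d and u :: "nat \<Rightarrow> 'x" by (simp add: tuple_mset_def)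
  have de: "d = e" using assms by (metis s)
  then show ?thesis
    using image_mset_eq_implies_permutes[of "{..<d}" u v] assms unfolding tuple_mset_def
    by (metis finite_lessThan lessThan_iff)
qed

text \<open>
  The coordinates of the dominating multiset can be prescribed, since a permutation of the
  coordinates can be absorbed into the columns of the matrix.
\<close>

lemma dominates_tuple:
  assumes "dominates U W" "U = tuple_mset d u"
  shows "\<exists>w a. W = tuple_mset d w \<and> a \<in> mats_over d C \<and>
     matnorm d a \<le> 1 \<and> (\<forall>i<d. w i = mat_apply d (\<lambda>i j. \<rho> (a i j)) u i)"
proof -
  obtain e v w a where *: "U = tuple_mset e v" "W = tuple_mset e w" "a \<in> mats_over e C"
     "matnorm e a \<le> 1" "\<And>i. i < e \<Longrightarrow> w i = mat_apply e (\<lambda>i j. \<rho> (a i j)) v i"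
    using assms unfolding dominates_def by blast
  obtain p where e: "e = d" and p: "p permutes {..<d}" "\<And>i. i < d \<Longrightarrow> v i = u (p i)"
    using tuple_mset_perm[of e v d u] *(1) assms(2) by auto
  define q where "q = inv p"
  have q: "q permutes {..<d}" "\<And>i. q (p i) = i" "\<And>i. p (q i) = i"
    unfolding q_def using p by (auto intro: permutes_inv simp: permutes_inverses)
  have re: "mat_apply d (\<lambda>i j. b i (q j)) x i = mat_apply d b (\<lambda>j. x (p j)) i"
    for b :: "nat \<Rightarrow> nat \<Rightarrow> 'c::chilbert \<Rightarrow>\<^sub>L 'c" and x i
    unfolding mat_apply_def using sum.permute[OF p(1), of "\<lambda>j. blinfun_apply (b i (q j)) (x j)"] by (simp add: q o_def)
  have "matnorm d (\<lambda>i j. a i (q j)) \<le> 1"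
  proof (rule matnorm_leI)
    fix x :: "nat \<Rightarrow> 'k"
    have "vec_norm d (\<lambda>j. x (p j)) = vec_norm d x"
      by (rule power2_eq_imp_eq)
        (use sum.permute[OF p(1), of "\<lambda>j. (norm (x j))\<^sup>2"] in \<open>simp_all add: vec_norm_sq vec_norm_nonneg o_def\<close>)
    moreover have "vec_norm d (mat_apply d a (\<lambda>j. x (p j))) \<le> 1 * vec_norm d (\<lambda>j. x (p j))"
      using vec_norm_mat_apply_le[of d a] mult_right_mono[OF *(4) vec_norm_nonneg] unfolding e by (meson order_trans)
    ultimately show "vec_norm d (mat_apply d (\<lambda>i j. a i (q j)) x) \<le> 1 * vec_norm d x"
      unfolding re by simp
  qed simp
  moreover have "(\<lambda>i j. a i (q j)) \<in> mats_over d C"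
    using *(3) q(1) permutes_in_image[OF q(1)] by (auto simp: mats_over_def e)
  moreover have "w i = mat_apply d (\<lambda>i j. \<rho> (a i (q j))) u i" if "i < d" for i
    using *(5) that unfolding re[of "\<lambda>i j. \<rho> (a i j)"] e by (auto intro: mat_apply_cong simp: p(2))
  ultimately show ?thesis using *(2) e by blast
qed

lemma dominates_refl: "dominates U U"
proof -
  obtain xs where xs: "U = mset xs" using ex_mset by metis
  define d where "d = length xs"
  define a :: "nat \<Rightarrow> nat \<Rightarrow> 'k \<Rightarrow>\<^sub>L 'k" where "a i j = (if i = j then id_blinfun else 0)" for i j
  have U: "U = tuple_mset d (\<lambda>i. xs ! i)"
  proof -
    have "mset (map ((!) xs) [0..<length xs]) = mset xs" by (simp only: map_nth)
    then show ?thesis by (simp only: xs tuple_mset_def d_def mset_map mset_upt lessThan_atLeast0)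
  qed
  have "a i j y = (if i = j then y else 0)" for i j y by (simp add: a_def)
  then have ap: "mat_apply d a x i = x i" if "i < d" for x i
    using that by (simp add: mat_apply_def)
  have "\<rho> (a i j) y = (if i = j then y else 0)" for i j y by (simp add: a_def unital \<rho>_linear)
  then have ap': "x i = mat_apply d (\<lambda>i j. \<rho> (a i j)) x i" if "i < d" for x i
    using that by (simp add: mat_apply_def)
  have "matnorm d a \<le> 1"
  proof (rule matnorm_leI)
    fix x :: "nat \<Rightarrow> 'k"
    show "vec_norm d (mat_apply d a x) \<le> 1 * vec_norm d x" using vec_norm_cong[of d "mat_apply d a x" x] ap by simp
  qed simp
  moreover have "a \<in> mats_over d C" by (simp add: mats_over_def a_def C_closed)
  ultimately show ?thesis unfolding dominates_def using U ap' by blast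
qed

text \<open>
  The product of two contraction matrices is one; the homomorphism sends it to the product of the
  images.
\<close>

lemma dominates_trans:
  assumes "dominates U V" "dominates V W"
  shows "dominates U W"
proof -
  obtain d u v a where 1: "U = tuple_mset d u" "V = tuple_mset d v" "a \<in> mats_over d C"
     "matnorm d a \<le> 1" "\<And>i. i < d \<Longrightarrow> v i = mat_apply d (\<lambda>i j. \<rho> (a i j)) u i"
    using assms(1) unfolding dominates_def by blast
  obtain w b where 2: "W = tuple_mset d w" "b \<in> mats_over d C"
     "matnorm d b \<le> 1" "\<And>i. i < d \<Longrightarrow> w i = mat_apply d (\<lambda>i j. \<rho> (b i j)) v i"
    using dominates_tuple[OF assms(2) 1(2)] by blast
  have "w i = mat_apply d (\<lambda>i j. \<rho> (mat_mul d b a i j)) u i" if i: "i < d" for i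
  proof -
    have "mat_apply d (\<lambda>i j. \<rho> (mat_mul d b a i j)) u i
       = mat_apply d (mat_mul d (\<lambda>i j. \<rho> (b i j)) (\<lambda>i j. \<rho> (a i j))) u i"
      by (rule mat_apply_cong) (use mat_mul_C(2)[OF 2(2) 1(3)] i in auto)
    also have "\<dots> = w i" unfolding mat_apply_mul 2(4)[OF i]
      by (rule mat_apply_cong) (use i in \<open>auto simp: 1(5)\<close>)
    finally show ?thesis by simp
  qed
  moreover have "matnorm d (mat_mul d b a) \<le> 1"
    using matnorm_mul_le[of d b a] mult_mono[OF 2(3) 1(4)] matnorm_nonneg[of d a] by simp
  ultimately show ?thesis unfolding dominates_def using 1 2 mat_mul_C(1)[OF 2(2) 1(3)] by blast
qed

lemma tuple_mset_append: "tuple_mset (d + e) (vec_append d u v) = tuple_mset d u + tuple_mset e v"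
proof -
  have suc: "tuple_mset (Suc n) w = add_mset (w n) (tuple_mset n w)" for n and w :: "nat \<Rightarrow> 'x"
    by (simp add: tuple_mset_def lessThan_Suc)
  have "tuple_mset d (vec_append d u v) = tuple_mset d u"
    unfolding tuple_mset_def by (rule image_mset_cong) (simp add: vec_append_def)
  then show ?thesis
    by (induction e) (simp_all add: suc vec_append_def, simp add: tuple_mset_def)
qed

text \<open>
  The block sum of two contraction matrices is a contraction.
\<close>

lemma dominates_add:
  assumes "dominates U W" "dominates U' W'"
  shows "dominates (U + U') (W + W')"
proof -
  obtain d u w a where 1: "U = tuple_mset d u" "W = tuple_mset d w" "a \<in> mats_over d C"
     "matnorm d a \<le> 1" "\<And>i. i < d \<Longrightarrow> w i = mat_apply d (\<lambda>i j. \<rho> (a i j)) u i"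
    using assms(1) unfolding dominates_def by blast
  obtain e u' w' b where 2: "U' = tuple_mset e u'" "W' = tuple_mset e w'" "b \<in> mats_over e C"
     "matnorm e b \<le> 1" "\<And>i. i < e \<Longrightarrow> w' i = mat_apply e (\<lambda>i j. \<rho> (b i j)) u' i"
    using assms(2) unfolding dominates_def by blast
  have \<rho>c: "(\<lambda>i j. \<rho> (mat_sum d a b i j)) = mat_sum d (\<lambda>i j. \<rho> (a i j)) (\<lambda>i j. \<rho> (b i j))"
    by (auto simp: mat_sum_def \<rho>_linear fun_eq_iff)
  have "vec_append d w w' i = mat_apply (d + e) (\<lambda>i j. \<rho> (mat_sum d a b i j)) (vec_append d u u') i"
    if "i < d + e" for i
  proof (cases "i < d")
    case True
    then show ?thesis unfolding \<rho>c
      by (auto simp: mat_apply_sum vec_append_def 1(5) intro: mat_apply_cong)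
  next
    case False
    then obtain k where k: "i = d + k" by (metis add_diff_inverse_nat)
    then have "k < e" using that by simp
    then show ?thesis unfolding \<rho>c k
      by (auto simp: mat_apply_sum vec_append_def 2(5) intro: mat_apply_cong)
  qed
  moreover have "mat_sum d a b \<in> mats_over (d + e) C"
    using 1(3) 2(3) by (auto simp: mats_over_def mat_sum_def C_closed)
  moreover have "matnorm (d + e) (mat_sum d a b) \<le> 1" by (intro matnorm_sum_le1 1 2)
  ultimately show ?thesis unfolding dominates_def 1(1,2) 2(1,2) tuple_mset_append[symmetric] by blast
qed

text \<open>
  Complete boundedness enters through this estimate, in which matrices of every size occur with the
  same constant.
\<close>

lemma dominates_bound:
  assumes K: "\<And>d a. a \<in> mats_over d C \<Longrightarrow> matnorm d (\<lambda>i j. \<rho> (a i j)) \<le> K * matnorm d a" and "0 \<le> K"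
    and "dominates U W"
  shows "(\<Sum>h\<in>#W. (norm h)\<^sup>2) \<le> K\<^sup>2 * (\<Sum>h\<in>#U. (norm h)\<^sup>2)"
proof -
  obtain d u w a where 1: "U = tuple_mset d u" "W = tuple_mset d w" "a \<in> mats_over d C"
     "matnorm d a \<le> 1" "\<And>i. i < d \<Longrightarrow> w i = mat_apply d (\<lambda>i j. \<rho> (a i j)) u i"
    using assms(3) unfolding dominates_def by blast
  have s: "(\<Sum>h\<in>#tuple_mset d u. (norm h)\<^sup>2) = (vec_norm d u)\<^sup>2" for u :: "nat \<Rightarrow> 'h"
    by (simp add: tuple_mset_def vec_norm_sq sum_unfold_sum_mset multiset.map_comp o_def)
  have "vec_norm d w \<le> matnorm d (\<lambda>i j. \<rho> (a i j)) * vec_norm d u"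
    using vec_norm_mat_apply_le[of d "\<lambda>i j. \<rho> (a i j)" u] vec_norm_cong[OF 1(5)] by simp
  also have "\<dots> \<le> K * vec_norm d u"
    using K[OF 1(3)] mult_left_mono[OF 1(4) \<open>0 \<le> K\<close>] by (intro mult_right_mono vec_norm_nonneg) auto
  finally have "(vec_norm d w)\<^sup>2 \<le> (K * vec_norm d u)\<^sup>2" by (intro power_mono vec_norm_nonneg)
  then show ?thesis unfolding 1(1,2) s by (simp add: power_mult_distrib)
qed

lemma dominates_single:
  assumes "c \<in> C" "norm c \<le> 1"
  shows "dominates {#h#} {#\<rho> c h#}"
  unfolding dominates_def
proof (intro exI conjI allI impI)
  show "{#h#} = tuple_mset 1 (\<lambda>_. h)" "{#\<rho> c h#} = tuple_mset 1 (\<lambda>_. \<rho> c h)"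
    by (simp_all add: tuple_mset_def lessThan_Suc)
  show "(\<lambda>_ _. c) \<in> mats_over 1 C" using assms by (simp add: mats_over_def)
  show "matnorm 1 (\<lambda>_ _. c) \<le> 1"
  proof (rule matnorm_leI)
    fix x :: "nat \<Rightarrow> 'k"
    have "norm (c (x 0)) \<le> 1 * norm (x 0)"
      using norm_blinfun[of c "x 0"] mult_right_mono[OF assms(2) norm_ge_zero[of "x 0"]] by linarith
    then show "vec_norm 1 (mat_apply 1 (\<lambda>_ _. c) x) \<le> 1 * vec_norm 1 x"
      by (simp add: vec_norm_def mat_apply_def lessThan_Suc)
  qed simp
qed (simp add: mat_apply_def)

text \<open>
  A scalar unitary matrix.  Since the rotated family rotates back to the original one, a weight that
  decreases along domination is unchanged here, which gives it the parallelogram law.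
\<close>

lemma dominates_rotation:
  "dominates {#h, k#} {#(1 / sqrt 2) *\<^sub>R (h + k), (1 / sqrt 2) *\<^sub>R (h - k)#}"
  unfolding dominates_def
proof (intro exI conjI allI impI)
  let ?s = "1 / sqrt 2"
  define a :: "nat \<Rightarrow> nat \<Rightarrow> 'k \<Rightarrow>\<^sub>L 'k" where
    "a i j = op_scale (of_real (if i = 1 \<and> j = 1 then - ?s else ?s)) id_blinfun" for i j
  define u where "u i = (if i = 0 then h else k)" for i :: nat
  have two: "{..<2::nat} = {0, 1}" by auto
  show "{#h, k#} = tuple_mset 2 u" by (simp add: tuple_mset_def two u_def)
  show "{#?s *\<^sub>R (h + k), ?s *\<^sub>R (h - k)#} = tuple_mset 2 (\<lambda>i. if i = 0 then ?s *\<^sub>R (h + k) else ?s *\<^sub>R (h - k))"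
    by (simp add: tuple_mset_def two)
  show "a \<in> mats_over 2 C" by (simp add: mats_over_def a_def C_closed)
  show "matnorm 2 a \<le> 1"
  proof (rule matnorm_leI)
    fix x :: "nat \<Rightarrow> 'k"
    have "mat_apply 2 a x 0 = ?s *\<^sub>R (x 0 + x 1)" "mat_apply 2 a x 1 = ?s *\<^sub>R (x 0 - x 1)"
      by (simp_all add: mat_apply_def two a_def op_scale_of_real blinfun.scaleR_left algebra_simps)
    moreover have "(norm (?s *\<^sub>R (y + z)))\<^sup>2 + (norm (?s *\<^sub>R (y - z)))\<^sup>2 = (norm y)\<^sup>2 + (norm z)\<^sup>2" for y z :: 'k
      by (simp add: power_divide power2_norm_eq_inner inner_add inner_diff inner_commute field_simps)
    ultimately have "(vec_norm 2 (mat_apply 2 a x))\<^sup>2 = (vec_norm 2 x)\<^sup>2"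
      by (simp add: vec_norm_sq two)
    then show "vec_norm 2 (mat_apply 2 a x) \<le> 1 * vec_norm 2 x" 
      by (simp add: power2_eq_iff_nonneg vec_norm_nonneg)
  qed simp
  fix i :: nat assume "i < 2"
  then have "i = 0 \<or> i = 1" by auto
  moreover have "\<rho> (a i j) = (if i = 1 \<and> j = 1 then - ?s else ?s) *\<^sub>R id_blinfun" for i j
    unfolding a_def \<rho>_linear(2)[OF C_closed(1)] unital by (rule op_scale_of_real)
  ultimately show "(if i = 0 then ?s *\<^sub>R (h + k) else ?s *\<^sub>R (h - k)) = mat_apply 2 (\<lambda>i j. \<rho> (a i j)) u i"
    by (auto simp: mat_apply_def two u_def blinfun.scaleR_left algebra_simps)
qed

end

section \<open>Similarity to a star-homomorphism\<close>

lemma scaleC_simps: "scaleC 1 x = x" "scaleC 0 x = 0" "scaleC (- c) x = - scaleC c x"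
  "scaleC c (- x) = - scaleC c x" "scaleC c (x - y) = scaleC c x - scaleC c y"
  "scaleC (of_real r) x = r *\<^sub>R x" for x :: "'h::chilbert"
proof -
  interpret s: bounded_linear "scaleC c :: 'h \<Rightarrow> 'h" by (rule bounded_linear_scaleC)
  show one: "scaleC 1 x = x" for x :: 'h using scaleR_scaleC[of 1 x] by simp
  show "scaleC (of_real r) x = r *\<^sub>R x" by (simp add: scaleR_scaleC)
  show z: "scaleC 0 x = 0" using scaleR_scaleC[of 0 x] by simp
  show "scaleC (- c) x = - scaleC c x" using scaleC_add_left[of c "- c" x] z by (simp add: add_eq_0_iff)
  show "scaleC c (- x) = - scaleC c x" by (rule linear_neg[OF bounded_linear.linear[OF bounded_linear_scaleC]])
  show "scaleC c (x - y) = scaleC c x - scaleC c y" by (rule s.diff)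
qed

lemma scaleC_eq_Re_Im: "scaleC c x = Re c *\<^sub>R x + Im c *\<^sub>R scaleC \<i> x" for x :: "'h::chilbert"
proof -
  have "of_real (Re c) + of_real (Im c) * \<i> = c" by (simp add: complex_eq_iff)
  then have "scaleC c x = scaleC (of_real (Re c) + of_real (Im c) * \<i>) x" by simp
  then show ?thesis by (simp add: scaleC_add_left scaleC_simps flip: scaleC_scaleC)
qed

lemma inner_scaleC_ii: "inner (scaleC \<i> x) (scaleC \<i> y) = inner x y" for x :: "'h::chilbert"
proof -
  have "cinner (scaleC \<i> x) (scaleC \<i> y) = \<i> * cnj (cinner (scaleC \<i> y) x)"
    by (metis cinner_commute cinner_scaleC_left)
  also have "\<dots> = \<i> * cnj (\<i> * cnj (cinner x y))"
    by (metis cinner_commute cinner_scaleC_left)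
  finally show ?thesis by (simp add: inner_eq_Re_cinner)
qed

lemma inverse_pair_apply:
  assumes "inverse_pair X X'"
  shows "X (X' x) = x" and "X' (X x) = x"
  using assms unfolding inverse_pair_def
  by (metis blinfun_apply_blinfun_compose blinfun_apply_id_blinfun id_apply)+

context operator_algebra_hom
begin

text \<open>
  A weight that decreases along domination and is comparable to \<open>\<parallel>h\<parallel>\<^sup>2\<close> is a quadratic form \<open>Q\<close>
  with \<open>Q (\<rho> c h) \<le> \<parallel>c\<parallel>\<^sup>2 Q h\<close>; up to a scalar, \<open>X\<close> is the square root of the operator that
  represents it, so \<open>\<parallel>X h\<parallel>\<^sup>2\<close> is proportional to \<open>Q h\<close>.
\<close>

lemma similar_to_contractive:
  assumes K: "\<And>d a. a \<in> mats_over d C \<Longrightarrow> matnorm d (\<lambda>i j. \<rho> (a i j)) \<le> K * matnorm d a" and K1: "1 \<le> K"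
  shows "\<exists>X X'. inverse_pair X X' \<and> (\<forall>c\<in>C. norm (X o\<^sub>L \<rho> c o\<^sub>L X') \<le> norm c)"
proof -
  have "\<exists>Q. (\<forall>h :: 'h. (norm h)\<^sup>2 \<le> Q h \<and> Q h \<le> K\<^sup>2 * (norm h)\<^sup>2) \<and>
    (\<forall>U W. dominates U W \<longrightarrow> (\<Sum>h\<in>#W. Q h) \<le> (\<Sum>h\<in>#U. Q h))"
    using K1 by (intro invariant_weight_exists dominates_refl dominates_add)
      (auto intro: dominates_trans dominates_bound[OF K])
  then obtain Q :: "'h \<Rightarrow> real" where lower: "\<And>h. (norm h)\<^sup>2 \<le> Q h" and upper: "\<And>h. Q h \<le> K\<^sup>2 * (norm h)\<^sup>2"
    and mono: "\<And>U W. dominates U W \<Longrightarrow> (\<Sum>h\<in>#W. Q h) \<le> (\<Sum>h\<in>#U. Q h)" by blast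
  have Q0: "Q 0 = 0" using lower[of 0] upper[of 0] by simp
  have contr: "Q (\<rho> c h) \<le> Q h" if "c \<in> C" "norm c \<le> 1" for c h
    using mono[OF dominates_single[OF that, of h]] by simp
  let ?s = "1 / sqrt 2"
  have rot_le: "Q (?s *\<^sub>R (h + k)) + Q (?s *\<^sub>R (h - k)) \<le> Q h + Q k" for h k
    using mono[OF dominates_rotation[of h k]] by simp
  have rot: "Q (?s *\<^sub>R (h + k)) + Q (?s *\<^sub>R (h - k)) = Q h + Q k" for h k
  proof (rule antisym[OF rot_le])
    have "?s *\<^sub>R (?s *\<^sub>R (h + k) + ?s *\<^sub>R (h - k)) = h" "?s *\<^sub>R (?s *\<^sub>R (h + k) - ?s *\<^sub>R (h - k)) = k"
      by (simp_all add: algebra_simps flip: scaleR_add_left)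
    then show "Q h + Q k \<le> Q (?s *\<^sub>R (h + k)) + Q (?s *\<^sub>R (h - k))"
      using rot_le[of "?s *\<^sub>R (h + k)" "?s *\<^sub>R (h - k)"] by simp
  qed
  have root2: "?s *\<^sub>R (x + x) = sqrt 2 *\<^sub>R x" for x :: 'h
    by (simp add: scaleR_2[symmetric] real_div_sqrt)
  \<comment> \<open>Rotating the pair \<open>x, x\<close> gives the pair \<open>sqrt 2 x, 0\<close>.\<close>
  have dbl: "Q (sqrt 2 *\<^sub>R x) = 2 * Q x" for x using rot[of x x] unfolding root2 by (simp add: Q0)
  have par: "Q (x + y) + Q (x - y) = 2 * Q x + 2 * Q y" for x y
    using rot[of "sqrt 2 *\<^sub>R x" "sqrt 2 *\<^sub>R y"] by (simp add: dbl flip: scaleR_add_right scaleR_diff_right)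
  define B where "B x y = (Q (x + y) - Q (x - y)) / 4" for x y
  have nonneg: "0 \<le> Q x" for x using lower[of x] by (meson order_trans zero_le_power2)
  note bil = parallelogram_imp_bilinear[of Q "K\<^sup>2", OF par nonneg upper zero_le_power2, folded B_def]
  interpret B: bounded_bilinear B by (rule bil(1))
  have Q_scale: "Q (r *\<^sub>R x) = r\<^sup>2 * Q x" for r x
    unfolding bil(2)[symmetric] by (simp add: B.scaleR_left B.scaleR_right power2_eq_square)
  obtain T :: "'h \<Rightarrow>\<^sub>L 'h" where T: "\<And>x y. B x y = inner (T x) y"
    using bilinear_form_operator[OF bil(1)] by blast
  have T_sym: "inner (T x) y = inner x (T y)" for x y
    using bil(3)[of x y] by (simp add: T inner_commute)
  \<comment> \<open>Multiplication by \<open>i\<close> and its inverse are contractions in the algebra; invariance of \<open>Q\<close> under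
    them makes the representing operator complex-linear.\<close>
  have Q_ii: "Q (scaleC \<i> x) = Q x" for x
  proof (rule antisym)
    have le: "Q (scaleC c x) \<le> Q x" if "cmod c \<le> 1" for c x
    proof -
      have "norm (op_scale c (id_blinfun :: 'k \<Rightarrow>\<^sub>L 'k)) \<le> 1"
        using that by (intro norm_blinfun_bound) (auto simp: norm_scaleC intro: mult_left_le_one_le)
      then show ?thesis
        using contr[OF C_closed(4)[OF C_closed(1)], of c x] by (simp add: \<rho>_linear C_closed unital)
    qed
    show "Q (scaleC \<i> x) \<le> Q x" by (rule le) simp
    show "Q x \<le> Q (scaleC \<i> x)" using le[of "- \<i>" "scaleC \<i> x"] by (simp add: scaleC_scaleC scaleC_simps)
  qed
  have B_ii: "B (scaleC \<i> x) (scaleC \<i> y) = B x y" for x y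
    unfolding B_def by (simp add: Q_ii flip: scaleC_add_right scaleC_simps(5))
  have T_ii: "T (scaleC \<i> x) = scaleC \<i> (T x)" for x
  proof -
    have "inner (T (scaleC \<i> x)) y = inner (scaleC \<i> (T x)) y" for y
    proof -
      have y: "y = scaleC \<i> (scaleC (- \<i>) y)" by (simp add: scaleC_scaleC scaleC_simps)
      have "inner (T (scaleC \<i> x)) y = B x (scaleC (- \<i>) y)" by (metis T B_ii y)
      also have "\<dots> = inner (scaleC \<i> (T x)) y" by (metis T inner_scaleC_ii y)
      finally show ?thesis .
    qed
    then have "inner (T (scaleC \<i> x) - scaleC \<i> (T x)) (T (scaleC \<i> x) - scaleC \<i> (T x)) = 0"
      by (simp add: inner_diff_left)
    then show ?thesis by simp
  qed
  have T_BH: "T \<in> BH"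
  proof -
    have "T (scaleC c x) = scaleC c (T x)" for c x
      by (simp only: scaleC_eq_Re_Im[of c x] scaleC_eq_Re_Im[of c "T x"] blinfun.add_right blinfun.scaleR_right T_ii)
    then show ?thesis by (simp add: BH_def)
  qed
  \<comment> \<open>The factor puts the spectrum of \<open>T / K\<^sup>2\<close> between \<open>1 / K\<^sup>2\<close> and 1, so \<open>1 - D\<close> has a square root.\<close>
  define D where "D = id_blinfun - (1 / K\<^sup>2) *\<^sub>R T"
  have D_form: "inner (D x) x = (norm x)\<^sup>2 - Q x / K\<^sup>2" for x
    using T[of x x] by (simp add: D_def blinfun.diff_left blinfun.scaleR_left inner_diff_left power2_norm_eq_inner bil(2))
  have D_sym: "inner (D x) y = inner x (D y)" for x y
    by (simp add: D_def blinfun.diff_left blinfun.scaleR_left inner_diff T_sym)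
  have Kp: "K\<^sup>2 > 0" "1 / K\<^sup>2 \<le> 1" using K1 by (auto simp: divide_le_eq one_le_power)
  have "norm D \<le> 1 - 1 / K\<^sup>2"
  proof (rule norm_le_of_quadratic_form[OF D_sym])
    fix x
    have "Q x / K\<^sup>2 \<le> (norm x)\<^sup>2" using upper[of x] Kp by (simp add: divide_le_eq mult.commute)
    moreover have "(norm x)\<^sup>2 / K\<^sup>2 \<le> Q x / K\<^sup>2" using lower[of x] Kp by (intro divide_right_mono) auto
    ultimately show "\<bar>inner (D x) x\<bar> \<le> (1 - 1 / K\<^sup>2) * (norm x)\<^sup>2" unfolding D_form by (simp add: algebra_simps)
  qed (use Kp in simp)
  then have D_norm: "norm D < 1" using Kp(1) by (smt (verit) divide_pos_pos)
  have D_BH: "D \<in> BH" unfolding D_def by (intro BH_closure T_BH)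
  obtain X X' where X: "inverse_pair X X'" and X_norm: "\<And>x. (norm (X x))\<^sup>2 = Q x / K\<^sup>2"
    using sqrt_one_minus[OF D_BH D_norm D_sym] D_form by auto
  have XX': "X (X' x) = x" for x
    by (rule inverse_pair_apply(1)[OF X])
  have Q_norm: "Q (\<rho> c h) \<le> (norm c)\<^sup>2 * Q h" if c: "c \<in> C" for c h
  proof (cases "c = 0")
    case True
    then show ?thesis by (simp add: \<rho>_linear Q0)
  next
    case False
    define e where "e = op_scale (of_real (1 / norm c)) c"
    have e: "e \<in> C" unfolding e_def by (rule C_closed(4)[OF c])
    have e1: "norm e \<le> 1" using False unfolding e_def op_scale_of_real by simp
    have "\<rho> e = (1 / norm c) *\<^sub>R \<rho> c" unfolding e_def \<rho>_linear(2)[OF c] by (rule op_scale_of_real)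
    then have "\<rho> c h = norm c *\<^sub>R \<rho> e h" using False by (simp add: blinfun.scaleR_left)
    then show ?thesis using contr[OF e e1, of h] by (simp add: Q_scale mult_left_mono)
  qed
  have "norm (X o\<^sub>L \<rho> c o\<^sub>L X') \<le> norm c" if c: "c \<in> C" for c
  proof (rule norm_blinfun_bound[OF norm_ge_zero])
    fix x
    have "(norm (X (\<rho> c (X' x))))\<^sup>2 \<le> (norm c)\<^sup>2 * Q (X' x) / K\<^sup>2"
      unfolding X_norm using Q_norm[OF c] by (intro divide_right_mono) auto
    also have "\<dots> = (norm c * norm x)\<^sup>2"
      using X_norm[of "X' x"] by (simp add: XX' power_mult_distrib)
    finally show "norm ((X o\<^sub>L \<rho> c o\<^sub>L X') x) \<le> norm c * norm x"
      by (simp add: power2_le_iff_abs_le)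
  qed
  then show ?thesis using X by blast
qed

text \<open>
  For self-adjoint \<open>a\<close> the norm of \<open>1 + t i a\<close> exceeds 1 only to second order in \<open>t\<close>.  A contractive
  \<open>\<rho>\<close> inherits this, so the first order term \<open>2 t Re \<langle>i \<rho>(a) h, h\<rangle>\<close> has to vanish.
\<close>

lemma contractive_skew_form_zero:
  assumes contr: "\<And>c. c \<in> C \<Longrightarrow> norm (\<rho> c) \<le> norm c" and a: "a \<in> C" "adjoint_pair a a"
  shows "inner (scaleC \<i> (\<rho> a h)) h = 0"
proof -
  define e where "e = inner (scaleC \<i> (\<rho> a h)) h"
  have skew: "inner (scaleC \<i> (a x)) x = 0" for x
  proof -
    have "cinner (a x) x = cnj (cinner (a x) x)"
      using a(2) cinner_commute unfolding adjoint_pair_def by metis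
    then have "Im (cinner (a x) x) = 0" by (metis cnj.simps(2) neg_equal_zero)
    then show ?thesis by (simp add: inner_eq_Re_cinner cinner_scaleC_left)
  qed
  have expand: "(norm (x + t *\<^sub>R scaleC \<i> y))\<^sup>2 = (norm x)\<^sup>2 + 2 * t * inner (scaleC \<i> y) x + t\<^sup>2 * (norm y)\<^sup>2"
    for x y :: "'x::chilbert" and t
  proof -
    have "(norm (scaleC \<i> y))\<^sup>2 = (norm y)\<^sup>2" by (simp add: norm_scaleC)
    then show ?thesis unfolding power2_norm_eq_inner
      by (simp add: inner_add inner_commute power2_eq_square algebra_simps)
  qed
  have key: "t * (2 * e) \<le> t\<^sup>2 * ((norm a)\<^sup>2 * (norm h)\<^sup>2)" for t
  proof -
    define b where "b = id_blinfun + t *\<^sub>R op_scale \<i> a"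
    have t_scale: "t *\<^sub>R op_scale \<i> a = op_scale (of_real t) (op_scale \<i> a)" by (simp only: op_scale_of_real)
    have b: "b \<in> C" unfolding b_def t_scale by (intro C_closed a)
    have \<rho>b: "\<rho> b h = h + t *\<^sub>R scaleC \<i> (\<rho> a h)"
      unfolding b_def t_scale by (simp add: \<rho>_linear C_closed a unital blinfun.add_left scaleC_simps)
    have "norm b \<le> sqrt (1 + t\<^sup>2 * (norm a)\<^sup>2)"
    proof (rule norm_blinfun_bound)
      fix x
      have "(norm (b x))\<^sup>2 = (norm x)\<^sup>2 + t\<^sup>2 * (norm (a x))\<^sup>2"
        using expand[of x t "a x"] by (simp add: b_def blinfun.add_left blinfun.scaleR_left skew)
      also have "\<dots> \<le> (norm x)\<^sup>2 + t\<^sup>2 * (norm a * norm x)\<^sup>2"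
        by (intro add_left_mono mult_left_mono power_mono norm_blinfun) auto
      also have "\<dots> = (sqrt (1 + t\<^sup>2 * (norm a)\<^sup>2) * norm x)\<^sup>2"
        by (simp add: power_mult_distrib algebra_simps)
      finally show "norm (b x) \<le> sqrt (1 + t\<^sup>2 * (norm a)\<^sup>2) * norm x"
        by (rule power2_le_imp_le) simp
    qed simp
    then have "norm (\<rho> b) \<le> sqrt (1 + t\<^sup>2 * (norm a)\<^sup>2)" using contr[OF b] by linarith
    then have "norm (\<rho> b h) \<le> sqrt (1 + t\<^sup>2 * (norm a)\<^sup>2) * norm h"
      using norm_blinfun[of "\<rho> b" h] mult_right_mono[of _ _ "norm h"] by (meson norm_ge_zero order_trans)
    then have "(norm (\<rho> b h))\<^sup>2 \<le> (sqrt (1 + t\<^sup>2 * (norm a)\<^sup>2) * norm h)\<^sup>2" by (intro power_mono) auto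
    also have "\<dots> = (norm h)\<^sup>2 + t\<^sup>2 * ((norm a)\<^sup>2 * (norm h)\<^sup>2)" by (simp add: power_mult_distrib algebra_simps)
    finally have "2 * t * e + t\<^sup>2 * (norm (\<rho> a h))\<^sup>2 \<le> t\<^sup>2 * ((norm a)\<^sup>2 * (norm h)\<^sup>2)"
      unfolding \<rho>b expand e_def by simp
    moreover have "0 \<le> t\<^sup>2 * (norm (\<rho> a h))\<^sup>2" by simp
    ultimately show ?thesis by linarith
  qed
  have "e = 0"
  proof (rule ccontr)
    assume e0: "e \<noteq> 0"
    define \<beta> where "\<beta> = (norm a)\<^sup>2 * (norm h)\<^sup>2 + 1"
    have \<beta>: "\<beta> > 0" by (simp add: \<beta>_def add_nonneg_pos)
    \<comment> \<open>With \<open>t = e / \<beta>\<close> the linear term outweighs the quadratic one.\<close>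
    have "(e / \<beta>) * (2 * e) \<le> (e / \<beta>)\<^sup>2 * \<beta>"
      using key[of "e / \<beta>"] mult_left_mono[of "\<beta> - 1" \<beta> "(e / \<beta>)\<^sup>2"] unfolding \<beta>_def by simp
    also have "\<dots> = (e / \<beta>) * e" using \<beta> by (simp add: power2_eq_square)
    finally have "e\<^sup>2 / \<beta> \<le> 0" using \<beta> by (simp add: power2_eq_square field_simps)
    then show False using e0 \<beta> by (simp add: divide_le_0_iff)
  qed
  then show ?thesis by (simp add: e_def)
qed

text \<open>
  \<open>T\<close> and \<open>S\<close> are recovered from the self-adjoint elements \<open>T + S\<close> and \<open>i (T - S)\<close>, whose images are
  self-adjoint because their skew forms vanish.  The conclusion is in terms of the real inner product,
  which determines the norms.
\<close>

lemma contractive_imp_star_preserving: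
  assumes contr: "\<And>c. c \<in> C \<Longrightarrow> norm (\<rho> c) \<le> norm c" and BH: "\<And>c. c \<in> C \<Longrightarrow> \<rho> c \<in> BH"
    and S: "S \<in> C" and T: "T \<in> C" and adj: "adjoint_pair T S"
  shows "inner (\<rho> T x) y = inner x (\<rho> S y)"
proof -
  have ii: "scaleC \<i> (scaleC \<i> z) = - z" for z :: 'h by (simp add: scaleC_scaleC scaleC_simps)
  have sa: "inner (\<rho> a x) y = inner x (\<rho> a y)" if a: "a \<in> C" "adjoint_pair a a" for a x y
  proof -
    have comm: "\<rho> a (scaleC \<i> z) = scaleC \<i> (\<rho> a z)" for z using BH[OF a(1)] by (simp add: BH_def)
    have z: "inner (scaleC \<i> (\<rho> a h)) h = 0" for h by (rule contractive_skew_form_zero[OF contr a])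
    have pol: "inner (scaleC \<i> (\<rho> a h)) k = - inner h (scaleC \<i> (\<rho> a k))" for h k
      using z[of "h + k"] z[of h] z[of k]
      by (simp add: blinfun.add_right scaleC_add_right inner_add inner_commute)
    have "inner (\<rho> a x) y = inner (scaleC \<i> (\<rho> a x)) (scaleC \<i> y)" by (simp add: inner_scaleC_ii)
    also have "\<dots> = inner x (\<rho> a y)" unfolding pol comm ii by simp
    finally show ?thesis .
  qed
  have cr: "cinner u (scaleC c v) = cnj c * cinner u v" "cinner u (v + w) = cinner u v + cinner u w"
    for u v w :: 'k and c
    by (metis cinner_commute cinner_scaleC_left complex_cnj_mult) (metis cinner_add_left cinner_commute complex_cnj_add)
  have adj': "cinner (S u) v = cinner u (T v)" for u v
    using adj cinner_commute unfolding adjoint_pair_def by metis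
  have adj: "cinner (T u) v = cinner u (S v)" for u v using adj by (simp add: adjoint_pair_def)
  define p where "p = T + S"
  define q where "q = op_scale \<i> (T + op_scale (- 1) S)"
  have C: "p \<in> C" "q \<in> C" unfolding p_def q_def by (intro C_closed S T)+
  have "adjoint_pair p p" unfolding adjoint_pair_def p_def
    by (simp add: blinfun.add_left cr cinner_add_left adj adj')
  from sa[OF C(1) this] have p: "inner (\<rho> T x) y + inner (\<rho> S x) y = inner x (\<rho> T y) + inner x (\<rho> S y)" for x y
    by (simp add: p_def \<rho>_linear S T blinfun.add_left inner_add)
  have "adjoint_pair q q" unfolding adjoint_pair_def q_def
    by (simp add: blinfun.add_left cr cinner_add_left cinner_scaleC_left adj adj' algebra_simps)
  note q0 = sa[OF C(2) this]
  have \<rho>q: "\<rho> q z = scaleC \<i> (\<rho> T z - \<rho> S z)" for z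
    by (simp add: q_def \<rho>_linear S T C_closed blinfun.add_left scaleC_simps)
  have comm: "\<rho> q (scaleC \<i> z) = scaleC \<i> (\<rho> q z)" for z using BH[OF C(2)] by (simp add: BH_def)
  have "inner (\<rho> T x - \<rho> S x) y = inner (\<rho> q x) (scaleC \<i> y)" unfolding \<rho>q by (simp add: inner_scaleC_ii)
  also have "\<dots> = inner x (- (\<rho> T y - \<rho> S y))" unfolding q0 comm unfolding \<rho>q ii ..
  finally show ?thesis using p[of x y] by (simp add: inner_diff inner_minus_right)
qed

lemma conjugate:
  assumes "inverse_pair X X'"
  shows "operator_algebra_hom C (\<lambda>c. X o\<^sub>L \<rho> c o\<^sub>L X')"
proof -
  note XX' = inverse_pair_apply(1)[OF assms] and X'X = inverse_pair_apply(2)[OF assms]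
  have X: "X (scaleC c x) = scaleC c (X x)" for c x
    using assms by (simp add: inverse_pair_def BH_def)
  show ?thesis
  proof
    show "unital_operator_algebra C" by (rule algebra)
    show "op_linear_on C (\<lambda>c. X o\<^sub>L \<rho> c o\<^sub>L X')"
      unfolding op_linear_on_def
      by (auto intro!: blinfun_eqI simp: \<rho>_linear blinfun.add_left blinfun.add_right X)
    show "X o\<^sub>L \<rho> id_blinfun o\<^sub>L X' = id_blinfun" by (auto intro!: blinfun_eqI simp: unital XX')
    show "X o\<^sub>L \<rho> (S o\<^sub>L T) o\<^sub>L X' = (X o\<^sub>L \<rho> S o\<^sub>L X') o\<^sub>L (X o\<^sub>L \<rho> T o\<^sub>L X')" if "S \<in> C" "T \<in> C" for S T
      using that by (auto intro!: blinfun_eqI simp: mult X'X)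
  qed
qed

end

text \<open>
  Paulsen's similarity theorem for a completely bounded homomorphism of a self-adjoint algebra.
\<close>

lemma (in operator_algebra_hom) similar_to_star_hom:
  assumes "completely_bounded_on C \<rho>" and BH: "\<And>c. c \<in> C \<Longrightarrow> \<rho> c \<in> BH"
  shows "\<exists>X X'. inverse_pair X X' \<and> operator_algebra_hom C (\<lambda>c. X o\<^sub>L \<rho> c o\<^sub>L X') \<and>
    (\<forall>S\<in>C. \<forall>T\<in>C. adjoint_pair T S \<longrightarrow>
      (\<forall>x y. inner ((X o\<^sub>L \<rho> T o\<^sub>L X') x) y = inner x ((X o\<^sub>L \<rho> S o\<^sub>L X') y)))"
proof -
  obtain K where K: "\<And>d a. a \<in> mats_over d C \<Longrightarrow> matnorm d (\<lambda>i j. \<rho> (a i j)) \<le> K * matnorm d a"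
    using assms(1) unfolding completely_bounded_on_def by blast
  have "matnorm d (\<lambda>i j. \<rho> (a i j)) \<le> max 1 K * matnorm d a" if "a \<in> mats_over d C" for d a
    using K[OF that] mult_right_mono[of K "max 1 K" "matnorm d a"] matnorm_nonneg[of d a] by linarith
  then obtain X X' where X: "inverse_pair X X'" and contr: "\<And>c. c \<in> C \<Longrightarrow> norm (X o\<^sub>L \<rho> c o\<^sub>L X') \<le> norm c"
    using similar_to_contractive[of "max 1 K"] by auto
  interpret \<pi>: operator_algebra_hom C "\<lambda>c. X o\<^sub>L \<rho> c o\<^sub>L X'" by (rule conjugate[OF X])
  have "X o\<^sub>L \<rho> c o\<^sub>L X' \<in> BH" if "c \<in> C" for c
    using X BH[OF that] by (intro BH_closure) (auto simp: inverse_pair_def)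
  then show ?thesis
    using X \<pi>.operator_algebra_hom_axioms \<pi>.contractive_imp_star_preserving[OF contr] by blast
qed

section \<open>Matrix norms under star-homomorphisms\<close>

lemma matnorm_conjugate_le:
  fixes X X' :: "'a::chilbert \<Rightarrow>\<^sub>L 'a"
  shows
  "matnorm d (\<lambda>i j. X o\<^sub>L m i j o\<^sub>L X') \<le> norm X * norm X' * matnorm d m"
proof (rule matnorm_leI)
  fix x :: "nat \<Rightarrow> 'a"
  have le: "vec_norm d (\<lambda>i. Z (z i)) \<le> norm Z * vec_norm d z" for Z :: "'a \<Rightarrow>\<^sub>L 'a" and z
    unfolding vec_norm_def using L2_set_mono[of "{..<d}" "\<lambda>i. norm (Z (z i))" "\<lambda>i. norm Z * norm (z i)"]
    by (simp add: norm_blinfun L2_set_right_distrib)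
  have "mat_apply d (\<lambda>i j. X o\<^sub>L m i j o\<^sub>L X') x = (\<lambda>i. X (mat_apply d m (\<lambda>i. X' (x i)) i))"
    by (simp add: mat_apply_def blinfun.sum_right)
  then have "vec_norm d (mat_apply d (\<lambda>i j. X o\<^sub>L m i j o\<^sub>L X') x)
      \<le> norm X * vec_norm d (mat_apply d m (\<lambda>i. X' (x i)))" using le[of X] by simp
  also have "\<dots> \<le> norm X * (matnorm d m * vec_norm d (\<lambda>i. X' (x i)))"
    by (intro mult_left_mono vec_norm_mat_apply_le) simp
  also have "\<dots> \<le> norm X * (matnorm d m * (norm X' * vec_norm d x))"
    by (intro mult_left_mono le matnorm_nonneg norm_ge_zero)
  finally show "vec_norm d (mat_apply d (\<lambda>i j. X o\<^sub>L m i j o\<^sub>L X') x) \<le> norm X * norm X' * matnorm d m * vec_norm d x"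
    by (simp add: mult_ac)
qed (simp add: matnorm_nonneg)

lemma matnorm_le_conjugate:
  fixes X X' :: "'a::chilbert \<Rightarrow>\<^sub>L 'a"
  assumes "inverse_pair X X'"
  shows "matnorm d m \<le> norm X' * norm X * matnorm d (\<lambda>i j. X o\<^sub>L m i j o\<^sub>L X')"
proof -
  have "X' o\<^sub>L (X o\<^sub>L m i j o\<^sub>L X') o\<^sub>L X = m i j" for i j
    by (auto intro!: blinfun_eqI simp: inverse_pair_apply[OF assms])
  then show ?thesis using matnorm_conjugate_le[of d X' "\<lambda>i j. X o\<^sub>L m i j o\<^sub>L X'" X] by simp
qed

lemma sum_inner_le_vec_norm: "(\<Sum>i<d. inner (x i) (y i)) \<le> vec_norm d x * vec_norm d y"
proof -
  have "(\<Sum>i<d. inner (x i) (y i)) \<le> (\<Sum>i<d. \<bar>norm (x i)\<bar> * \<bar>norm (y i)\<bar>)"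
    by (intro sum_mono) (simp add: norm_cauchy_schwarz)
  also have "\<dots> \<le> vec_norm d x * vec_norm d y" unfolding vec_norm_def by (rule L2_set_mult_ineq)
  finally show ?thesis .
qed

text \<open>
  With \<open>m'\<close> the adjoint matrix of \<open>m\<close>, these two inequalities and submultiplicativity amount to the
  C*-identity for operator matrices.
\<close>

lemma matnorm_adjoint:
  fixes m m' :: "nat \<Rightarrow> nat \<Rightarrow> ('a::chilbert \<Rightarrow>\<^sub>L 'a)"
  assumes adj: "\<And>i j x y. i < d \<Longrightarrow> j < d \<Longrightarrow> inner (m i j x) y = inner x (m' j i y)"
  shows "(matnorm d m)\<^sup>2 \<le> matnorm d (mat_mul d m' m)" and "matnorm d m' \<le> matnorm d m"
proof -
  have mv: "(\<Sum>i<d. inner (mat_apply d m x i) (y i)) = (\<Sum>i<d. inner (x i) (mat_apply d m' y i))" for x y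
  proof -
    have "(\<Sum>i<d. inner (mat_apply d m x i) (y i)) = (\<Sum>i<d. \<Sum>j<d. inner (x j) (m' j i (y i)))"
      unfolding mat_apply_def inner_sum_left by (intro sum.cong refl) (simp add: adj)
    also have "\<dots> = (\<Sum>j<d. \<Sum>i<d. inner (x j) (m' j i (y i)))" by (rule sum.swap)
    finally show ?thesis unfolding mat_apply_def inner_sum_right .
  qed
  have sq: "(vec_norm d x)\<^sup>2 = (\<Sum>i<d. inner (x i) (x i))" for x :: "nat \<Rightarrow> 'a"
    by (simp add: vec_norm_sq power2_norm_eq_inner)
  let ?M = "matnorm d (mat_mul d m' m)"
  have "matnorm d m \<le> sqrt ?M"
  proof (rule matnorm_leI)
    fix x :: "nat \<Rightarrow> 'a"
    have "(vec_norm d (mat_apply d m x))\<^sup>2 = (\<Sum>i<d. inner (x i) (mat_apply d (mat_mul d m' m) x i))"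
      unfolding sq mv mat_apply_mul ..
    also have "\<dots> \<le> vec_norm d x * vec_norm d (mat_apply d (mat_mul d m' m) x)" by (rule sum_inner_le_vec_norm)
    also have "\<dots> \<le> vec_norm d x * (?M * vec_norm d x)"
      by (intro mult_left_mono vec_norm_mat_apply_le vec_norm_nonneg)
    also have "\<dots> = (sqrt ?M * vec_norm d x)\<^sup>2"
      by (simp add: power_mult_distrib matnorm_nonneg power2_eq_square mult_ac)
    finally show "vec_norm d (mat_apply d m x) \<le> sqrt ?M * vec_norm d x"
      by (rule power2_le_imp_le) (simp add: matnorm_nonneg vec_norm_nonneg)
  qed (simp add: matnorm_nonneg)
  from power_mono[OF this matnorm_nonneg, of 2] show "(matnorm d m)\<^sup>2 \<le> ?M" by (simp add: matnorm_nonneg)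
  show "matnorm d m' \<le> matnorm d m"
  proof (rule matnorm_leI)
    fix y :: "nat \<Rightarrow> 'a"
    let ?v = "mat_apply d m' y"
    have "(vec_norm d ?v)\<^sup>2 = (\<Sum>i<d. inner (mat_apply d m ?v i) (y i))" unfolding sq mv ..
    also have "\<dots> \<le> vec_norm d (mat_apply d m ?v) * vec_norm d y" by (rule sum_inner_le_vec_norm)
    also have "\<dots> \<le> (matnorm d m * vec_norm d ?v) * vec_norm d y"
      by (intro mult_right_mono vec_norm_mat_apply_le vec_norm_nonneg)
    finally have *: "vec_norm d ?v * vec_norm d ?v \<le> vec_norm d ?v * (matnorm d m * vec_norm d y)"
      by (simp add: power2_eq_square mult_ac)
    show "vec_norm d ?v \<le> matnorm d m * vec_norm d y"
    proof (cases "vec_norm d ?v = 0")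
      case False
      then have "0 < vec_norm d ?v" using vec_norm_nonneg[of d ?v] by simp
      then show ?thesis using * by simp
    qed (simp add: matnorm_nonneg vec_norm_nonneg)
  qed (rule matnorm_nonneg)
qed

text \<open>
  The C*-identity improves any constant in the assumed bound to its square root: \<open>\<parallel>\<rho>(a)\<parallel>\<^sup>2\<close> is at most
  \<open>\<parallel>\<rho>(a\<^sup>* a)\<parallel> \<le> K \<parallel>\<sigma>(a\<^sup>* a)\<parallel> \<le> K \<parallel>\<sigma>(a)\<parallel>\<^sup>2\<close>.  Iteration brings the constant down to 1.
\<close>

lemma star_hom_matnorm_le:
  assumes "operator_algebra_hom C \<rho>" and "operator_algebra_hom C \<sigma>"
    and star_closed: "\<And>T. T \<in> C \<Longrightarrow> \<exists>S\<in>C. adjoint_pair T S"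
    and star\<rho>: "\<And>S T x y. S \<in> C \<Longrightarrow> T \<in> C \<Longrightarrow> adjoint_pair T S \<Longrightarrow> inner (\<rho> T x) y = inner x (\<rho> S y)"
    and star\<sigma>: "\<And>S T x y. S \<in> C \<Longrightarrow> T \<in> C \<Longrightarrow> adjoint_pair T S \<Longrightarrow> inner (\<sigma> T x) y = inner x (\<sigma> S y)"
    and bound: "\<And>a. a \<in> mats_over d C \<Longrightarrow> matnorm d (\<lambda>i j. \<rho> (a i j)) \<le> K * matnorm d (\<lambda>i j. \<sigma> (a i j))"
    and "0 < K" and a: "a \<in> mats_over d C"
  shows "matnorm d (\<lambda>i j. \<rho> (a i j)) \<le> matnorm d (\<lambda>i j. \<sigma> (a i j))"
proof -
  interpret \<rho>: operator_algebra_hom C \<rho> by fact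
  interpret \<sigma>: operator_algebra_hom C \<sigma> by fact
  define N where "N a = matnorm d (\<lambda>i j. \<rho> (a i j))" for a
  define M where "M a = matnorm d (\<lambda>i j. \<sigma> (a i j))" for a
  have M_nonneg: "0 \<le> M a" for a by (simp add: M_def matnorm_nonneg)
  obtain s where s: "\<And>T. T \<in> C \<Longrightarrow> s T \<in> C" "\<And>T. T \<in> C \<Longrightarrow> adjoint_pair T (s T)"
    using star_closed by metis
  define P where "P a = mat_mul d (\<lambda>i j. s (a j i)) a" for a
  have P: "P a \<in> mats_over d C" "(N a)\<^sup>2 \<le> N (P a)" "M (P a) \<le> (M a)\<^sup>2" if a: "a \<in> mats_over d C" for a
  proof -
    have aC: "a i j \<in> C" if "i < d" "j < d" for i j using a that by (simp add: mats_over_def)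
    have a': "(\<lambda>i j. s (a j i)) \<in> mats_over d C" using a by (simp add: mats_over_def s)
    show "P a \<in> mats_over d C" unfolding P_def by (rule \<rho>.mat_mul_C[OF a' a])
    have "N (P a) = matnorm d (mat_mul d (\<lambda>i j. \<rho> (s (a j i))) (\<lambda>i j. \<rho> (a i j)))"
      unfolding N_def P_def by (intro matnorm_cong \<rho>.mat_mul_C[OF a' a])
    then show "(N a)\<^sup>2 \<le> N (P a)"
      unfolding N_def using matnorm_adjoint(1)[of d "\<lambda>i j. \<rho> (a i j)" "\<lambda>i j. \<rho> (s (a j i))"] star\<rho> aC s by simp
    have "M (P a) = matnorm d (mat_mul d (\<lambda>i j. \<sigma> (s (a j i))) (\<lambda>i j. \<sigma> (a i j)))"
      unfolding M_def P_def by (intro matnorm_cong \<sigma>.mat_mul_C[OF a' a])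
    also have "\<dots> \<le> matnorm d (\<lambda>i j. \<sigma> (s (a j i))) * M a" unfolding M_def by (rule matnorm_mul_le)
    also have "\<dots> \<le> M a * M a"
      using matnorm_adjoint(2)[of d "\<lambda>i j. \<sigma> (a i j)" "\<lambda>i j. \<sigma> (s (a j i))"] star\<sigma> aC s
      by (intro mult_right_mono M_nonneg) (simp add: M_def)
    finally show "M (P a) \<le> (M a)\<^sup>2" by (simp add: power2_eq_square)
  qed
  have iter: "N a \<le> K powr ((1/2) ^ n) * M a" if "a \<in> mats_over d C" for n a
    using that
  proof (induction n arbitrary: a)
    case 0
    then show ?case using bound \<open>0 < K\<close> by (simp add: N_def M_def)
  next
    case (Suc n)
    have "(N a)\<^sup>2 \<le> N (P a)" by (rule P(2)[OF Suc.prems])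
    also have "\<dots> \<le> K powr ((1/2) ^ n) * M (P a)" by (rule Suc.IH[OF P(1)[OF Suc.prems]])
    also have "\<dots> \<le> K powr ((1/2) ^ n) * (M a)\<^sup>2" by (intro mult_left_mono P(3) Suc.prems) simp
    also have "\<dots> = (K powr ((1/2) ^ Suc n) * M a)\<^sup>2"
      by (simp add: power_mult_distrib power2_eq_square powr_add[symmetric])
    finally show ?case
      by (rule power2_le_imp_le) (simp add: M_nonneg)
  qed
  have "(\<lambda>n. K powr ((1/2) ^ n) * M a) \<longlonglongrightarrow> K powr 0 * M a"
    using \<open>0 < K\<close> by (intro tendsto_intros LIMSEQ_power_zero) auto
  then have "N a \<le> K powr 0 * M a"
    using iter[OF a] by (auto intro: LIMSEQ_le_const)
  then show ?thesis using \<open>0 < K\<close> by (simp add: N_def M_def)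
qed

section \<open>Completely isometric similarity\<close>

theorem theorem2p6:
  fixes A :: "('h1::chilbert \<Rightarrow>\<^sub>L 'h1) set"
    and B :: "('h2::chilbert \<Rightarrow>\<^sub>L 'h2) set"
    and C :: "('k::chilbert \<Rightarrow>\<^sub>L 'k) set"
    and \<theta> :: "('k \<Rightarrow>\<^sub>L 'k) \<Rightarrow> ('h1 \<Rightarrow>\<^sub>L 'h1)"
    and \<phi> :: "('h1 \<Rightarrow>\<^sub>L 'h1) \<Rightarrow> ('h2 \<Rightarrow>\<^sub>L 'h2)"
  assumes "unital_operator_algebra A"
    and "unital_operator_algebra B"
    and "unital_cstar_algebra C"
    and "unital_cb_isomorphism C A \<theta>"
    and "unital_cb_isomorphism A B \<phi>"
  shows "\<exists>X X' Y Y'. inverse_pair X X' \<and> inverse_pair Y Y' \<and>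
    (\<exists>\<Psi>. (\<forall>a\<in>A. \<Psi> (X o\<^sub>L a o\<^sub>L X') = Y o\<^sub>L \<phi> a o\<^sub>L Y') \<and>
      \<Psi> ` ((\<lambda>a. X o\<^sub>L a o\<^sub>L X') ` A) = (\<lambda>b. Y o\<^sub>L b o\<^sub>L Y') ` B \<and>
      completely_isometric_on ((\<lambda>a. X o\<^sub>L a o\<^sub>L X') ` A) \<Psi>)"
proof -
  have C: "unital_operator_algebra C" and star: "\<And>T. T \<in> C \<Longrightarrow> \<exists>S\<in>C. adjoint_pair T S"
    using assms(3) unfolding unital_cstar_algebra_def by blast+
  have \<theta>: "bij_betw \<theta> C A" "\<theta> id_blinfun = id_blinfun" "\<And>S T. S \<in> C \<Longrightarrow> T \<in> C \<Longrightarrow> \<theta> (S o\<^sub>L T) = \<theta> S o\<^sub>L \<theta> T"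
    and \<theta>_cb: "completely_bounded_on C \<theta>"
    using assms(4) unfolding unital_cb_isomorphism_def by blast+
  have \<phi>: "bij_betw \<phi> A B" "\<phi> id_blinfun = id_blinfun" "\<And>S T. S \<in> A \<Longrightarrow> T \<in> A \<Longrightarrow> \<phi> (S o\<^sub>L T) = \<phi> S o\<^sub>L \<phi> T"
    and \<phi>_cb: "completely_bounded_on A \<phi>" and \<phi>_inv_cb: "completely_bounded_on B (inv_into A \<phi>)"
    using assms(5) unfolding unital_cb_isomorphism_def by blast+
  have \<theta>_lin: "op_linear_on C \<theta>" and \<phi>_lin: "op_linear_on A \<phi>"
    using \<theta>_cb \<phi>_cb unfolding completely_bounded_on_def by blast+
  have \<theta>A: "\<theta> c \<in> A" if "c \<in> C" for c using \<theta>(1) that by (auto simp: bij_betw_def)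
  have \<phi>B: "\<phi> a \<in> B" if "a \<in> A" for a using \<phi>(1) that by (auto simp: bij_betw_def)
  have BH: "A \<subseteq> BH" "B \<subseteq> BH" using assms(1,2) by (auto simp: unital_operator_algebra_def)
  have \<phi>\<theta>_lin: "op_linear_on C (\<lambda>c. \<phi> (\<theta> c))"
    using \<theta>_lin \<phi>_lin \<theta>A unfolding op_linear_on_def by auto

  obtain K where K: "0 < K" "\<And>d a. a \<in> mats_over d A \<Longrightarrow> matnorm d (\<lambda>i j. \<phi> (a i j)) \<le> K * matnorm d a"
  proof -
    obtain K where K: "\<And>d a. a \<in> mats_over d A \<Longrightarrow> matnorm d (\<lambda>i j. \<phi> (a i j)) \<le> K * matnorm d a"
      using \<phi>_cb unfolding completely_bounded_on_def by blast
    have "matnorm d (\<lambda>i j. \<phi> (a i j)) \<le> max 1 K * matnorm d a" if "a \<in> mats_over d A" for d a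
      using K[OF that] mult_right_mono[of K "max 1 K" "matnorm d a"] matnorm_nonneg[of d a] by linarith
    then show ?thesis by (intro that[of "max 1 K"]) simp_all
  qed
  obtain L where L: "0 < L" "\<And>d a. a \<in> mats_over d A \<Longrightarrow> matnorm d a \<le> L * matnorm d (\<lambda>i j. \<phi> (a i j))"
  proof -
    obtain L where L: "\<And>d b. b \<in> mats_over d B \<Longrightarrow> matnorm d (\<lambda>i j. inv_into A \<phi> (b i j)) \<le> L * matnorm d b"
      using \<phi>_inv_cb unfolding completely_bounded_on_def by blast
    have "matnorm d a \<le> max 1 L * matnorm d (\<lambda>i j. \<phi> (a i j))" if a: "a \<in> mats_over d A" for d a
    proof -
      have "matnorm d a = matnorm d (\<lambda>i j. inv_into A \<phi> (\<phi> (a i j)))"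
        using a \<phi>(1) by (intro matnorm_cong) (auto simp: mats_over_def bij_betw_def)
      also have "\<dots> \<le> L * matnorm d (\<lambda>i j. \<phi> (a i j))"
        using a \<phi>B by (intro L) (simp add: mats_over_def)
      also have "\<dots> \<le> max 1 L * matnorm d (\<lambda>i j. \<phi> (a i j))"
        by (intro mult_right_mono matnorm_nonneg) simp
      finally show ?thesis .
    qed
    then show ?thesis by (intro that[of "max 1 L"]) simp_all
  qed
  have \<phi>\<theta>_cb: "completely_bounded_on C (\<lambda>c. \<phi> (\<theta> c))"
  proof -
    obtain M where M: "\<And>d a. a \<in> mats_over d C \<Longrightarrow> matnorm d (\<lambda>i j. \<theta> (a i j)) \<le> M * matnorm d a"
      using \<theta>_cb unfolding completely_bounded_on_def by blast
    have "matnorm d (\<lambda>i j. \<phi> (\<theta> (a i j))) \<le> K * M * matnorm d a" if a: "a \<in> mats_over d C" for d a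
    proof -
      have "(\<lambda>i j. \<theta> (a i j)) \<in> mats_over d A" using a \<theta>A by (simp add: mats_over_def)
      from K(2)[OF this] mult_left_mono[OF M[OF a], of K] show ?thesis
        using K(1) unfolding mult.assoc by linarith
    qed
    then show ?thesis unfolding completely_bounded_on_def using \<phi>\<theta>_lin by blast
  qed
  interpret \<theta>: operator_algebra_hom C \<theta> by standard (use C \<theta>_lin \<theta> in auto)
  interpret \<phi>\<theta>: operator_algebra_hom C "\<lambda>c. \<phi> (\<theta> c)"
    by standard (use C \<phi>\<theta>_lin \<theta> \<phi> \<theta>A in auto)
  obtain X X' where X: "inverse_pair X X'" and \<rho>: "operator_algebra_hom C (\<lambda>c. X o\<^sub>L \<theta> c o\<^sub>L X')"
    and \<rho>_star: "\<And>S T x y. S \<in> C \<Longrightarrow> T \<in> C \<Longrightarrow> adjoint_pair T S \<Longrightarrow>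
      inner ((X o\<^sub>L \<theta> T o\<^sub>L X') x) y = inner x ((X o\<^sub>L \<theta> S o\<^sub>L X') y)"
    using \<theta>.similar_to_star_hom[OF \<theta>_cb subsetD[OF BH(1) \<theta>A]] by auto
  obtain Y Y' where Y: "inverse_pair Y Y'" and \<sigma>: "operator_algebra_hom C (\<lambda>c. Y o\<^sub>L \<phi> (\<theta> c) o\<^sub>L Y')"
    and \<sigma>_star: "\<And>S T x y. S \<in> C \<Longrightarrow> T \<in> C \<Longrightarrow> adjoint_pair T S \<Longrightarrow>
      inner ((Y o\<^sub>L \<phi> (\<theta> T) o\<^sub>L Y') x) y = inner x ((Y o\<^sub>L \<phi> (\<theta> S) o\<^sub>L Y') y)"
    using \<phi>\<theta>.similar_to_star_hom[OF \<phi>\<theta>_cb subsetD[OF BH(2) \<phi>B[OF \<theta>A]]] by auto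
  have X'X: "X' o\<^sub>L (X o\<^sub>L a o\<^sub>L X') o\<^sub>L X = a" for a
    by (auto intro!: blinfun_eqI simp: inverse_pair_apply[OF X])
  have eq: "matnorm d (\<lambda>i j. Y o\<^sub>L \<phi> (\<theta> (c i j)) o\<^sub>L Y') = matnorm d (\<lambda>i j. X o\<^sub>L \<theta> (c i j) o\<^sub>L X')"
    if c: "c \<in> mats_over d C" for d c
  proof (rule antisym)
    let ?N = "\<lambda>c. matnorm d (\<lambda>i j. X o\<^sub>L \<theta> (c i j) o\<^sub>L X')"
    let ?M = "\<lambda>c. matnorm d (\<lambda>i j. Y o\<^sub>L \<phi> (\<theta> (c i j)) o\<^sub>L Y')"
    have mA: "(\<lambda>i j. \<theta> (c i j)) \<in> mats_over d A" if "c \<in> mats_over d C" for c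
      using that \<theta>A by (simp add: mats_over_def)
    \<comment> \<open>One constant serves both comparisons; the summand 1 keeps it positive on a zero space.\<close>
    define k where "k = norm X * norm X' * (norm Y * norm Y') * (K + L) + 1"
    have k: "0 < k" unfolding k_def using K(1) L(1) by (simp add: add_nonneg_pos)
    have "?M c \<le> k * ?N c" if "c \<in> mats_over d C" for c
    proof -
      have "?M c \<le> norm Y * norm Y' * matnorm d (\<lambda>i j. \<phi> (\<theta> (c i j)))" by (rule matnorm_conjugate_le)
      also have "\<dots> \<le> norm Y * norm Y' * (K * matnorm d (\<lambda>i j. \<theta> (c i j)))"
        by (intro mult_left_mono K mA that) simp
      also have "\<dots> \<le> norm Y * norm Y' * (K * (norm X' * norm X * ?N c))"
        using K(1) by (intro mult_left_mono matnorm_le_conjugate X) auto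
      also have "\<dots> = (norm X * norm X' * (norm Y * norm Y') * K) * ?N c" by simp
      also have "\<dots> \<le> k * ?N c"
        unfolding k_def using L(1) by (intro mult_right_mono matnorm_nonneg) (simp add: distrib_left)
      finally show ?thesis .
    qed
    then show "?M c \<le> ?N c" by (intro star_hom_matnorm_le[OF \<sigma> \<rho> star \<sigma>_star \<rho>_star _ k c])
    have "?N c \<le> k * ?M c" if "c \<in> mats_over d C" for c
    proof -
      have "?N c \<le> norm X * norm X' * matnorm d (\<lambda>i j. \<theta> (c i j))" by (rule matnorm_conjugate_le)
      also have "\<dots> \<le> norm X * norm X' * (L * matnorm d (\<lambda>i j. \<phi> (\<theta> (c i j))))"
        by (intro mult_left_mono L(2)[OF mA[OF that]]) simp
      also have "\<dots> \<le> norm X * norm X' * (L * (norm Y' * norm Y * ?M c))"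
        using L(1) by (intro mult_left_mono matnorm_le_conjugate Y) auto
      also have "\<dots> = (norm X * norm X' * (norm Y * norm Y') * L) * ?M c" by simp
      also have "\<dots> \<le> k * ?M c"
        unfolding k_def using K(1) by (intro mult_right_mono matnorm_nonneg) (simp add: distrib_left)
      finally show ?thesis .
    qed
    then show "?N c \<le> ?M c" by (intro star_hom_matnorm_le[OF \<rho> \<sigma> star \<rho>_star \<sigma>_star _ k c])
  qed
  define \<Psi> where "\<Psi> m = Y o\<^sub>L \<phi> (X' o\<^sub>L m o\<^sub>L X) o\<^sub>L Y'" for m
  have \<Psi>: "\<Psi> (X o\<^sub>L a o\<^sub>L X') = Y o\<^sub>L \<phi> a o\<^sub>L Y'" for a by (simp add: \<Psi>_def X'X)
  have "\<Psi> ` ((\<lambda>a. X o\<^sub>L a o\<^sub>L X') ` A) = (\<lambda>b. Y o\<^sub>L b o\<^sub>L Y') ` B"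
    unfolding image_image \<Psi> using \<phi>(1) by (auto simp: bij_betw_def)
  moreover have "completely_isometric_on ((\<lambda>a. X o\<^sub>L a o\<^sub>L X') ` A) \<Psi>"
    unfolding completely_isometric_on_def
  proof (intro conjI allI ballI)
    have com: "X (scaleC c x) = scaleC c (X x)" "Y (scaleC c y) = scaleC c (Y y)" for c x y
      using X Y by (auto simp: inverse_pair_def BH_def)
    have push: "(X o\<^sub>L S o\<^sub>L X') + (X o\<^sub>L T o\<^sub>L X') = X o\<^sub>L (S + T) o\<^sub>L X'"
      "op_scale c (X o\<^sub>L S o\<^sub>L X') = X o\<^sub>L op_scale c S o\<^sub>L X'" for S T c
      by (auto intro!: blinfun_eqI simp: blinfun.add_left blinfun.add_right com)
    have push': "(Y o\<^sub>L S o\<^sub>L Y') + (Y o\<^sub>L T o\<^sub>L Y') = Y o\<^sub>L (S + T) o\<^sub>L Y'"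
      "op_scale c (Y o\<^sub>L S o\<^sub>L Y') = Y o\<^sub>L op_scale c S o\<^sub>L Y'" for S T c
      by (auto intro!: blinfun_eqI simp: blinfun.add_left blinfun.add_right com)
    show "op_linear_on ((\<lambda>a. X o\<^sub>L a o\<^sub>L X') ` A) \<Psi>"
      using \<phi>_lin unfolding op_linear_on_def by (auto simp: \<Psi> push push')
  next
    fix d a assume "a \<in> mats_over d ((\<lambda>a. X o\<^sub>L a o\<^sub>L X') ` A)"
    then have "\<forall>i j. \<exists>c. i < d \<and> j < d \<longrightarrow> c \<in> C \<and> a i j = X o\<^sub>L \<theta> c o\<^sub>L X'"
      using \<theta>(1) unfolding mats_over_def bij_betw_def by blast
    then obtain c where c: "\<And>i j. i < d \<Longrightarrow> j < d \<Longrightarrow> c i j \<in> C \<and> a i j = X o\<^sub>L \<theta> (c i j) o\<^sub>L X'" by metis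
    then have "matnorm d (\<lambda>i j. \<Psi> (a i j)) = matnorm d (\<lambda>i j. Y o\<^sub>L \<phi> (\<theta> (c i j)) o\<^sub>L Y')"
      by (intro matnorm_cong) (simp add: \<Psi>)
    also have "\<dots> = matnorm d (\<lambda>i j. X o\<^sub>L \<theta> (c i j) o\<^sub>L X')"
      by (rule eq) (simp add: mats_over_def c)
    also have "\<dots> = matnorm d a" by (intro matnorm_cong) (simp add: c)
    finally show "matnorm d (\<lambda>i j. \<Psi> (a i j)) = matnorm d a" .
  qed
  ultimately show ?thesis using X Y \<Psi> by blast
qed

end
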